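(* Let $\beta\ge 1$ be real and let $k$ be a positive integer. For every integer $n\geq k$, $$C_{\beta,n-k,(k)}\le C_{\beta,n}(n\beta)^{k(k-1)\beta/2}.$$ Moreover, $$\lim_{n\to+\infty}\frac{C_{\beta,n-2,1}}{C_{\beta,n}n^\beta}=A_\beta,\qquad \lim_{n\to+\infty}\frac{C_{\beta,n-k,(k)}}{C_{\beta,n}n^{k(k-1)\beta/2}}=A_{\beta,k},$$ where $$A_{\beta,k}=\frac{(2\pi)^{1-k}(\Gamma(\beta/2+1))^k}{\Gamma(k\beta/2+1)}\prod_{j=1}^{k-1}\frac{\Gamma(j\beta/2+1)}{\Gamma((k+j)\beta/2+1)}\,(\beta/2)^{k(k-1)\beta/2}$$ and $$A_\beta=A_{\beta,2}=(2\pi)^{-1}\frac{(\beta/2)^\beta(\Gamma(\beta/2+1))^3}{\Gamma(3\beta/2+1)\Gamma(\beta+1)} .$$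
   Context: Partition functions: $C_{\beta,n}=\int_{[-\pi,\pi]^n}\prod_{j<l}|e^{i\theta_j}-e^{i\theta_l}|^\beta\,d\theta_1\cdots d\theta_n$. $C_{\beta,n_1,n_2}=\int_{[-\pi,\pi]^{n_1+n_2}}\prod_{j<l}|e^{i\theta_j}-e^{i\theta_l}|^{q_jq_l\beta}\,d\theta_1\cdots d\theta_{n_1+n_2}$ with $q_j=1$ for $1\le j\le n_1$ and $q_j=2$ for $n_1+1\le j\le n_1+n_2$. $C_{\beta,n_1,(k)}=\int_{[-\pi,\pi]^{n_1+1}}\prod_{j<l}|e^{i\theta_j}-e^{i\theta_l}|^{q_jq_l\beta}\,d\theta_1\cdots d\theta_{n_1+1}$ with $q_j=1$ for $1\le j\le n_1$ and $q_{n_1+1}=k$. *)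

theory Defs
  imports "HOL-Analysis.Analysis"
begin

text \<open>Particles are labelled \<open>1, \<dots>, N\<close>; the \<open>j\<close>-th one has charge \<open>q j\<close>. The integral is the
  Lebesgue integral over the cube \<open>[-pi, pi]\<^sup>N\<close>, a point of \<open>\<real>\<^sup>N\<close> being a function on \<open>{1..N}\<close>.\<close>

definition partition_fun :: "real \<Rightarrow> nat \<Rightarrow> (nat \<Rightarrow> nat) \<Rightarrow> real" where
  "partition_fun \<beta> N q =
     (LINT \<theta> : (\<Pi>\<^sub>E j\<in>{1..N}. {-pi..pi}) | (\<Pi>\<^sub>M j\<in>{1..N}. lborel).
        (\<Prod>(j, l) \<in> {(j, l). 1 \<le> j \<and> j < l \<and> l \<le> N}.
           cmod (cis (\<theta> j) - cis (\<theta> l)) powr (real (q j) * real (q l) * \<beta>)))"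

definition C_one :: "real \<Rightarrow> nat \<Rightarrow> real" where
  "C_one \<beta> n = partition_fun \<beta> n (\<lambda>_. 1)"

definition C_two :: "real \<Rightarrow> nat \<Rightarrow> nat \<Rightarrow> real" where
  "C_two \<beta> n1 n2 = partition_fun \<beta> (n1 + n2) (\<lambda>j. if j \<le> n1 then 1 else 2)"

definition C_charge :: "real \<Rightarrow> nat \<Rightarrow> nat \<Rightarrow> real" where
  "C_charge \<beta> n1 k = partition_fun \<beta> (n1 + 1) (\<lambda>j. if j \<le> n1 then 1 else k)"

definition A_charge :: "real \<Rightarrow> nat \<Rightarrow> real" where
  "A_charge \<beta> k =
     (2 * pi) powi (1 - int k) * Gamma (\<beta> / 2 + 1) ^ k / Gamma (real k * \<beta> / 2 + 1)
     * (\<Prod>j = 1..k - 1. Gamma (real j * \<beta> / 2 + 1) / Gamma (real (k + j) * \<beta> / 2 + 1))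
     * (\<beta> / 2) powr (real k * (real k - 1) * \<beta> / 2)"

definition A_two :: "real \<Rightarrow> real" where
  "A_two \<beta> =
     inverse (2 * pi) * (((\<beta> / 2) powr \<beta> * Gamma (\<beta> / 2 + 1) ^ 3)
       / (Gamma (3 * \<beta> / 2 + 1) * Gamma (\<beta> + 1)))"

end

theory Submission
  imports Defs "HOL-Probability.Probability"
begin

text \<open>Write \<open>l = \<beta> / 2\<close> and let the angles be independent and uniform. By rotation invariance the particle of
charge \<open>k\<close> may be placed at angle 0, so \<open>C_charge \<beta> m k\<close> is \<open>(2 pi) ^ (m + 1)\<close> times
\<open>M\<^sub>m(a) = E [\<Prod>j. \<bar>1 - z j\<bar> powr (2 a) * \<Prod>i<j. \<bar>z i - z j\<bar> powr \<beta>]\<close> at \<open>a = k l\<close>, with \<open>z j = cis (\<theta> j)\<close>; this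
is Morris's integral with its two exponents equal. Placing a particle of charge 1 in the same way gives
\<open>M\<^sub>m(0) = M\<^sub>m\<^sub>-\<^sub>1(l)\<close>, and \<open>C_one \<beta> n\<close> is the case \<open>k = 1\<close>. Everything therefore follows
from the closed form \<open>M\<^sub>m(a) = \<Prod>j<m. Gamma(l j + 2 a + 1) Gamma(l (j + 1) + 1) / (Gamma(l j + a + 1)\<^sup>2 Gamma(1 + l))\<close>
(\<open>morris_eq_morris_gamma\<close>), which is obtained in three steps.

Recursion (\<open>morris_plus_1\<close>). Following Aomoto, let \<open>u j = 1 - z j\<close> and insert \<open>\<Prod>j\<in>J. u j\<close> into the
integral. Integrating a derivative in one angle \<open>\<theta> p\<close>, \<open>p \<in> J\<close>, gives 0. The interaction contributes the kernels
\<open>(z p + z i) / (z p - z i)\<close>, which are antisymmetric under exchange of \<open>p\<close> and \<open>i\<close>; symmetrizing therefore either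
kills them (\<open>i \<in> J\<close>) or turns them into polynomials in the \<open>u j\<close> (\<open>i \<notin> J\<close>). The result is a first order recursion in
\<open>card J\<close> (\<open>aomoto_recursion\<close>). Using it once for the weight \<open>\<bar>u\<bar> powr (2 a)\<close> and once more for that weight times
\<open>cnj u\<close> expresses \<open>M\<^sub>m(a + 1) / M\<^sub>m(a)\<close> as a rational function of \<open>a\<close>.

Uniqueness (\<open>same_recursion_imp_proportional\<close>). \<open>M\<^sub>m\<close> is log-convex, being an average of exponentials
in \<open>a\<close>. As in the theorem of Bohr and Mollerup, log-convexity and the recursion determine the behaviour of
\<open>M\<^sub>m(x + s) / M\<^sub>m(x)\<close> for \<open>x \<rightarrow> \<infinity>\<close>, so \<open>M\<^sub>m\<close> is a constant multiple of the Gamma product.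

Normalization. The Gamma products also satisfy \<open>M\<^sub>m(0) = M\<^sub>m\<^sub>-\<^sub>1(l)\<close>, so by induction on \<open>m\<close> the constant
is 1.

With \<open>g i = Gamma (l i + 1)\<close>, the products then telescope to
\<open>C_charge \<beta> (n - k) k / C_one \<beta> n = B * \<Prod>i=1..k-1. g (n + i) / g (n - i)\<close>, where
\<open>A_charge \<beta> k = B * l powr (k (k - 1) l)\<close> (\<open>C_charge_over_C_one\<close>). Since \<open>Gamma (x + s) / Gamma x\<close> is asymptotic to \<open>x powr s\<close>
and \<open>\<Sum>i=1..k-1. 2 i l = k (k - 1) l\<close>, this gives the limit. For the inequality, \<open>B \<le> (2 pi) powi (1 - k)\<close> by
convexity of \<open>ln Gamma\<close>, and each of the \<open>k - 1\<close> ratios is at most \<open>e (2 l n) powr (2 i l)\<close> with \<open>e \<le> 2 pi\<close>. The claim about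
\<open>C_two\<close> is the case \<open>k = 2\<close>.\<close>

section \<open>Independent uniform angles\<close>

definition angle_measure :: "real measure" where
  "angle_measure = density lborel (\<lambda>x. ennreal (indicator {-pi..pi} x / (2 * pi)))"

abbreviation angles :: "'i set \<Rightarrow> ('i \<Rightarrow> real) measure" where
  "angles I \<equiv> PiM I (\<lambda>_. angle_measure)"

lemma sets_angle_measure [simp, measurable_cong]: "sets angle_measure = sets borel"
  by (simp add: angle_measure_def)

lemma space_angle_measure [simp]: "space angle_measure = UNIV"
  by (simp add: angle_measure_def)

lemma prob_space_angle_measure: "prob_space angle_measure"
proof
  have "emeasure angle_measure (space angle_measure)
      = (\<integral>\<^sup>+x. ennreal (1 / (2 * pi)) * indicator {-pi..pi} x \<partial>lborel)"
    unfolding angle_measure_def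
    by (simp add: emeasure_density, intro nn_integral_cong) (auto split: split_indicator)
  also have "\<dots> = ennreal (1 / (2 * pi)) * ennreal (2 * pi)"
    by (subst nn_integral_cmult_indicator) (auto simp: emeasure_lborel_Icc)
  also have "\<dots> = 1"
    by (subst ennreal_mult[symmetric]) auto
  finally show "emeasure angle_measure (space angle_measure) = 1" .
qed

interpretation angle: prob_space angle_measure
  by (rule prob_space_angle_measure)

interpretation angle_prod: product_prob_space "\<lambda>_. angle_measure" "I" for I
  by standard

lemma prob_space_angles: "prob_space (angles I)"
  by (rule prob_space_PiM) (rule prob_space_angle_measure)

lemma integral_angle_measure:
  fixes f :: "real \<Rightarrow> 'b::{banach, second_countable_topology}"
  assumes [measurable]: "f \<in> borel_measurable borel"
  shows "(\<integral>t. f t \<partial>angle_measure) = (1 / (2 * pi)) *\<^sub>R (LINT t : {-pi..pi} | lborel. f t)"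
proof -
  have "(\<integral>t. f t \<partial>angle_measure) = (\<integral>t. (indicator {-pi..pi} t / (2 * pi)) *\<^sub>R f t \<partial>lborel)"
    unfolding angle_measure_def by (intro integral_density) auto
  also have "\<dots> = (\<integral>t. (1 / (2 * pi)) *\<^sub>R (indicator {-pi..pi} t *\<^sub>R f t) \<partial>lborel)"
    by (intro Bochner_Integration.integral_cong) auto
  finally show ?thesis
    by (simp only: set_lebesgue_integral_def integral_scaleR_right)
qed

lemma integrable_angles:
  fixes f :: "('i \<Rightarrow> real) \<Rightarrow> 'b::{banach, second_countable_topology}"
  assumes "f \<in> borel_measurable (angles I)" and "\<And>\<theta>. norm (f \<theta>) \<le> B"
  shows "integrable (angles I) f"
  using assms
  by (intro finite_measure.integrable_const_bound[OF prob_space.finite_measure[OF prob_space_angles], where B = B]) auto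

lemma integral_angles_insert:
  fixes f :: "('i \<Rightarrow> real) \<Rightarrow> 'b::{banach, second_countable_topology}"
  assumes "finite I" "p \<notin> I" "f \<in> borel_measurable (angles (insert p I))" "\<And>\<theta>. norm (f \<theta>) \<le> B"
  shows "(\<integral>\<theta>. f \<theta> \<partial>angles (insert p I))
       = (\<integral>\<theta>. (\<integral>t. f (\<theta>(p := t)) \<partial>angle_measure) \<partial>angles I)"
  using assms by (intro angle_prod.product_integral_insert integrable_angles) auto

text \<open>The form of the fundamental theorem of calculus with finitely many exceptional points is what integration by
parts needs: for \<open>\<beta> = 1\<close> the interaction \<open>\<bar>z p - z i\<bar> powr \<beta>\<close> has a corner where two particles meet.\<close>

lemma integral_periodic_derivative_eq_0:
  fixes f f' :: "real \<Rightarrow> complex"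
  assumes S: "finite S" and cont: "continuous_on {-pi..pi} f" and per: "f (-pi) = f pi"
    and deriv: "\<And>t. t \<in> {-pi<..<pi} - S \<Longrightarrow> (f has_vector_derivative f' t) (at t)"
    and meas [measurable]: "f' \<in> borel_measurable borel" and bound: "\<And>t. norm (f' t) \<le> B"
  shows "(\<integral>t. f' t \<partial>angle_measure) = 0"
proof -
  have "(f' has_integral (f pi - f (-pi))) {-pi..pi}"
    using S cont deriv by (intro fundamental_theorem_of_calculus_interior_strong[where S = S]) auto
  then have int0: "integral {-pi..pi} f' = 0"
    by (simp add: per integral_unique)
  have "set_integrable lborel {-pi..pi} f'"
    unfolding set_integrable_def
  proof (rule integrableI_bounded_set_indicator[where B = B])
    show "emeasure lborel {-pi..pi} < \<infinity>" by (simp add: emeasure_lborel_Icc_eq)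
  qed (use bound in auto)
  then have "(LINT t : {-pi..pi} | lborel. f' t) = 0"
    using int0 by (simp add: set_borel_integral_eq_integral)
  then show ?thesis
    by (simp add: integral_angle_measure)
qed

lemma integral_angles_permute:
  fixes f :: "('i \<Rightarrow> real) \<Rightarrow> 'b::{banach, second_countable_topology}"
  assumes \<sigma>: "bij_betw \<sigma> I I" and f: "f \<in> borel_measurable (angles I)"
  shows "(\<integral>\<theta>. f (\<lambda>i\<in>I. \<theta> (\<sigma> i)) \<partial>angles I) = (\<integral>\<theta>. f \<theta> \<partial>angles I)"
proof -
  have m: "(\<lambda>\<theta>. \<lambda>i\<in>I. \<theta> (\<sigma> i)) \<in> measurable (angles I) (angles I)"
    using bij_betwE[OF \<sigma>] by (intro measurable_restrict) (auto intro!: measurable_component_singleton)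
  have d: "distr (angles I) (angles I) (\<lambda>\<theta>. \<lambda>i\<in>I. \<theta> (\<sigma> i)) = angles I"
    using \<sigma> by (intro distr_PiM_reindex prob_space_angle_measure)
      (auto simp: bij_betw_def)
  have "(\<integral>\<theta>. f \<theta> \<partial>angles I) = (\<integral>\<theta>. f \<theta> \<partial>distr (angles I) (angles I) (\<lambda>\<theta>. \<lambda>i\<in>I. \<theta> (\<sigma> i)))"
    by (simp only: d)
  also have "\<dots> = (\<integral>\<theta>. f (\<lambda>i\<in>I. \<theta> (\<sigma> i)) \<partial>angles I)"
    using m f by (rule integral_distr)
  finally show ?thesis ..
qed

subsection \<open>Rotation invariance\<close>

lemma nn_integral_angle_rotate:
  fixes g :: "complex \<Rightarrow> ennreal"
  assumes [measurable]: "g \<in> borel_measurable borel"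
  shows "(\<integral>\<^sup>+t. g (cis (s + t)) \<partial>angle_measure) = (\<integral>\<^sup>+t. g (cis t) \<partial>angle_measure)"
proof -
  define G where "G A = (\<integral>\<^sup>+t. g (cis t) * indicator A t \<partial>lborel)" for A :: "real set"
  have [measurable]: "(\<lambda>t. cis (a + t)) \<in> borel_measurable borel" for a
    by (intro borel_measurable_continuous_onI continuous_intros)
  have [measurable]: "cis \<in> borel_measurable borel"
    by (intro borel_measurable_continuous_onI continuous_intros)
  have shift: "(\<integral>\<^sup>+t. g (cis (a + t)) * indicator {c..<d} t \<partial>lborel) = G {a + c..<a + d}" for a c d
    unfolding G_def
    by (subst nn_integral_real_affine[where c = 1 and t = a]) (auto intro!: nn_integral_cong split: split_indicator)
  have per: "G {2 * pi * of_int n + c..<2 * pi * of_int n + d} = G {c..<d}" for n c d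
  proof -
    have "cis (2 * pi * of_int n + t) = cis t" for t
      by (simp add: cis_mult[symmetric])
    then show ?thesis using shift[of "2 * pi * of_int n" c d] by (simp add: G_def)
  qed
  have split: "G {c..<e} = G {c..<d} + G {d..<e}" if "c \<le> d" "d \<le> e" for c d e
  proof -
    have "(indicator {c..<e} :: real \<Rightarrow> ennreal) = (\<lambda>t. indicator {c..<d} t + indicator {d..<e} t)"
      using that by (intro ext) (auto split: split_indicator)
    then show ?thesis unfolding G_def
      by (simp add: distrib_left nn_integral_add)
  qed
  have angle: "(\<integral>\<^sup>+t. h t \<partial>angle_measure) = ennreal (1 / (2 * pi)) * (\<integral>\<^sup>+t. h t * indicator {-pi..<pi} t \<partial>lborel)"
    if [measurable]: "h \<in> borel_measurable borel" for h
  proof -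
    have "(\<integral>\<^sup>+t. h t \<partial>angle_measure) = (\<integral>\<^sup>+t. ennreal (indicator {-pi..pi} t / (2 * pi)) * h t \<partial>lborel)"
      unfolding angle_measure_def by (rule nn_integral_density) auto
    also have "\<dots> = (\<integral>\<^sup>+t. ennreal (1 / (2 * pi)) * (h t * indicator {-pi..<pi} t) \<partial>lborel)"
      using AE_lborel_singleton[of pi]
      by (intro nn_integral_cong_AE, elim eventually_mono) (auto split: split_indicator)
    finally show ?thesis by (simp add: nn_integral_cmult)
  qed
  \<comment> \<open>Reduce the shift modulo a full turn, so that the shifted interval wraps around only once.\<close>
  define n where "n = \<lfloor>s / (2 * pi)\<rfloor>"
  define r where "r = s - 2 * pi * of_int n"
  have "of_int n \<le> s / (2 * pi)" "s / (2 * pi) < of_int n + 1"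
    unfolding n_def by linarith+
  then have r: "0 \<le> r" "r < 2 * pi"
    by (auto simp: r_def field_simps)
  have "G {s + -pi..<s + pi} = G {r - pi..<r + pi}"
    using per[of n "r - pi" "r + pi"] by (simp add: r_def algebra_simps)
  also have "\<dots> = G {r - pi..<pi} + G {pi..<r + pi}"
    using r by (intro split) auto
  also have "G {pi..<r + pi} = G {-pi..<r - pi}"
    using per[of 1 "-pi" "r - pi"] by (simp add: algebra_simps)
  also have "G {r - pi..<pi} + G {-pi..<r - pi} = G {-pi..<pi}"
    using r by (subst split[of "-pi" "r - pi" pi]) (auto simp: add.commute)
  finally have "G {s + -pi..<s + pi} = G {-pi..<pi}" .
  then show ?thesis
    by (simp add: angle shift G_def)
qed

text \<open>Adding a constant to all angles leaves the interval \<open>[-pi, pi]\<close>, so the invariance is stated for functions of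
the points \<open>cis (\<theta> i)\<close> only, whose joint distribution is a product of rotation invariant measures.\<close>

lemma integral_angles_rotate:
  fixes F :: "('i \<Rightarrow> complex) \<Rightarrow> real"
  assumes fin: "finite I" and F [measurable]: "F \<in> borel_measurable (PiM I (\<lambda>_. borel))"
  shows "(\<integral>\<theta>. F (\<lambda>i\<in>I. cis (s + \<theta> i)) \<partial>angles I) = (\<integral>\<theta>. F (\<lambda>i\<in>I. cis (\<theta> i)) \<partial>angles I)"
proof -
  have [measurable]: "(\<lambda>t. cis (a + t)) \<in> borel_measurable borel" for a
    by (intro borel_measurable_continuous_onI continuous_intros)
  have d: "distr (angles I) (PiM I (\<lambda>_. borel)) (compose I (\<lambda>t. cis (a + t)))
         = PiM I (\<lambda>_. distr angle_measure borel (\<lambda>t. cis (a + t)))" for a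
  proof -
    \<comment> \<open>A probability measure on the Borel sets that only supplies the target sigma-algebra.\<close>
    define N :: "complex measure" where "N = return borel 0"
    have "distr (angles I) (PiM I (\<lambda>_. N)) (compose I (\<lambda>t. cis (a + t)))
         = PiM I (\<lambda>_. distr angle_measure N (\<lambda>t. cis (a + t)))"
      unfolding N_def by (rule distr_PiM_finite_prob_space') (auto intro!: fin prob_space_angle_measure prob_space_return)
    moreover have "distr (angles I) (PiM I (\<lambda>_. N)) (compose I (\<lambda>t. cis (a + t)))
                 = distr (angles I) (PiM I (\<lambda>_. borel)) (compose I (\<lambda>t. cis (a + t)))"
      by (intro distr_cong sets_PiM_cong) (auto simp: N_def)
    moreover have "distr angle_measure N (\<lambda>t. cis (a + t)) = distr angle_measure borel (\<lambda>t. cis (a + t))"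
      by (intro distr_cong) (auto simp: N_def)
    ultimately show ?thesis by simp
  qed
  have eq: "distr angle_measure borel (\<lambda>t. cis (s + t)) = distr angle_measure borel (\<lambda>t. cis (0 + t))"
  proof (rule measure_eqI)
    fix A assume "A \<in> sets (distr angle_measure borel (\<lambda>t. cis (s + t)))"
    then have [measurable]: "A \<in> sets borel" by simp
    have "emeasure (distr angle_measure borel (\<lambda>t. cis (a + t))) A
        = (\<integral>\<^sup>+t. indicator A (cis (a + t)) \<partial>angle_measure)" for a
    proof -
      have "emeasure (distr angle_measure borel (\<lambda>t. cis (a + t))) A
          = (\<integral>\<^sup>+z. indicator A z \<partial>distr angle_measure borel (\<lambda>t. cis (a + t)))" by simp
      also have "\<dots> = (\<integral>\<^sup>+t. indicator A (cis (a + t)) \<partial>angle_measure)"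
        by (rule nn_integral_distr) auto
      finally show ?thesis .
    qed
    from this[of s] this[of 0] show "emeasure (distr angle_measure borel (\<lambda>t. cis (s + t))) A
             = emeasure (distr angle_measure borel (\<lambda>t. cis (0 + t))) A"
      using nn_integral_angle_rotate[of "indicator A" s] by simp
  qed simp
  have "(\<integral>\<theta>. F (\<lambda>i\<in>I. cis (a + \<theta> i)) \<partial>angles I)
      = (\<integral>z. F z \<partial>distr (angles I) (PiM I (\<lambda>_. borel)) (compose I (\<lambda>t. cis (a + t))))" for a
    unfolding compose_def by (subst integral_distr) auto
  from this[of s] this[of 0] show ?thesis
    unfolding d eq by simp
qed

section \<open>Integration by parts in one angle\<close>

lemma cis_measurable [measurable (raw)]:
  "f \<in> borel_measurable M \<Longrightarrow> (\<lambda>x. cis (f x)) \<in> borel_measurable M"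
  by (rule borel_measurable_continuous_on[where f = cis]) (auto intro!: continuous_intros)

lemma cmod_cis_diff_powr:
  "cmod (cis t - cis w) powr (2 * l) = (2 - 2 * cos (t - w)) powr l"
proof -
  have "(cmod (cis t - cis w))\<^sup>2 = (cos t - cos w)\<^sup>2 + (sin t - sin w)\<^sup>2"
    by (simp add: cmod_power2)
  also have "\<dots> = ((cos t)\<^sup>2 + (sin t)\<^sup>2) + ((cos w)\<^sup>2 + (sin w)\<^sup>2) - 2 * (cos t * cos w + sin t * sin w)"
    by (simp add: power2_eq_square algebra_simps)
  also have "\<dots> = 2 - 2 * cos (t - w)"
    by (simp add: cos_diff)
  finally have "2 - 2 * cos (t - w) = (cmod (cis t - cis w)) powr 2"
    by simp
  then show ?thesis by (simp only: powr_powr)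
qed

lemma cot_half_angle:
  assumes "cis t \<noteq> cis w"
  shows "complex_of_real (2 * sin (t - w) / (2 - 2 * cos (t - w)))
       = \<i> * (cis t + cis w) / (cis t - cis w)"
proof -
  define z where "z = cis t * cis (- w)"
  have z: "cis t = z * cis w" by (simp add: z_def cis_mult)
  have ziz: "z * cnj z = 1" by (simp add: z_def cis_mult cis_cnj)
  have z1: "z \<noteq> 1" using assms z by auto
  have z0: "z \<noteq> 0" using ziz by auto
  have wt: "cos (w - t) = cos (t - w)" "sin (w - t) = - sin (t - w)"
    using cos_minus[of "t - w"] sin_minus[of "t - w"] by simp_all
  have c: "complex_of_real (2 * cos (t - w)) = z + cnj z"
    by (simp add: z_def cis_mult cis_cnj complex_eq_iff wt)
  have s: "complex_of_real (2 * sin (t - w)) = - \<i> * (z - cnj z)"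
    by (simp add: z_def cis_mult cis_cnj complex_eq_iff wt)
  have iz: "cnj z = 1 / z" using ziz z0 by (simp add: field_simps)
  have "complex_of_real (2 * sin (t - w) / (2 - 2 * cos (t - w))) = - \<i> * (z - cnj z) / (2 - (z + cnj z))"
    using c s by simp
  also have "2 - (z + cnj z) = - ((z - 1) * (z - 1) / z)"
    unfolding iz using z0 by (simp add: field_simps)
  also have "- \<i> * (z - cnj z) = - \<i> * ((z + 1) * (z - 1) / z)"
    unfolding iz using z0 by (simp add: field_simps)
  also have "- \<i> * ((z + 1) * (z - 1) / z) / - ((z - 1) * (z - 1) / z) = \<i> * (z + 1) / (z - 1)"
    using z0 z1 by (simp add: divide_simps)
  also have "\<dots> = \<i> * (cis t + cis w) / (cis t - cis w)"
    unfolding z using z1 by (simp add: divide_simps) (simp add: algebra_simps)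
  finally show ?thesis .
qed

text \<open>The logarithmic derivative of \<open>\<bar>z - c\<bar>\<close> along the circle is half a cotangent of half the angle between \<open>z\<close> and \<open>c\<close>.
The rational expression \<open>\<i> (z + c) / (z - c)\<close> for it makes the later symmetrization a polynomial identity.\<close>

lemma has_vector_derivative_cmod_cis_diff_powr:
  assumes "cis t \<noteq> cis w"
  shows "((\<lambda>t. complex_of_real (cmod (cis t - cis w) powr (2 * l))) has_vector_derivative
      complex_of_real (cmod (cis t - cis w) powr (2 * l)) * (of_real l * (\<i> * (cis t + cis w) / (cis t - cis w)))) (at t)"
proof -
  define q where "q t = 2 - 2 * cos (t - w)" for t
  have "q t \<noteq> 0"
  proof
    assume "q t = 0"
    then have "cmod (cis t - cis w) powr 2 = 0"
      using cmod_cis_diff_powr[of t w 1] by (simp add: q_def)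
    with assms show False by simp
  qed
  moreover have "q t \<ge> 0" using cos_le_one[of "t - w"] by (simp add: q_def)
  ultimately have q: "q t > 0" by linarith
  have dq: "(q has_real_derivative 2 * sin (t - w)) (at t)"
    unfolding q_def by (auto intro!: derivative_eq_intros)
  have "((\<lambda>t. q t powr l) has_real_derivative q t powr l * (l * (2 * sin (t - w) / q t))) (at t)"
    using q by (auto intro!: derivative_eq_intros dq simp: powr_diff)
  then have "((\<lambda>t. complex_of_real (q t powr l)) has_vector_derivative
      complex_of_real (q t powr l * (l * (2 * sin (t - w) / q t)))) (at t)"
    by (intro has_vector_derivative_of_real) (simp add: has_real_derivative_iff_has_vector_derivative)
  then show ?thesis
    using cot_half_angle[OF assms]
    by (simp only: cmod_cis_diff_powr q_def of_real_mult)
qed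

lemma finite_cis_preimage: "finite {t \<in> {-pi..pi}. cis t = z}"
proof (rule finite_subset)
  show "{t \<in> {-pi..pi}. cis t = z} \<subseteq> {Arg z, -pi}"
    using Arg_cis by (force simp: less_le)
qed simp

lemma cmod_cis_diff_le: "cmod (cis s - cis t) \<le> 2"
  using norm_triangle_ineq4[of "cis s" "cis t"] by simp

lemma cmod_one_minus_cis_le: "cmod (1 - cis t) \<le> 2"
  using cmod_cis_diff_le[of 0 t] by simp

text \<open>The pole of the cotangent is of first order, so the factor with exponent \<open>2 * l \<ge> 1\<close> compensates it. This is the
place where \<open>\<beta> \<ge> 1\<close> enters.\<close>

lemma powr_mult_cot_bound:
  assumes "l \<ge> 1 / 2"
  shows "cmod (of_real (cmod (cis s - cis t) powr (2 * l)) * ((cis s + cis t) / (cis s - cis t))) \<le> 2 * 2 powr (2 * l - 1)"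
proof (cases "cis s = cis t")
  case False
  let ?x = "cmod (cis s - cis t)"
  have "cmod (of_real (?x powr (2 * l)) * ((cis s + cis t) / (cis s - cis t)))
      = ?x powr (2 * l - 1) * cmod (cis s + cis t)"
    using False by (simp add: norm_mult norm_divide powr_diff)
  also have "\<dots> \<le> 2 powr (2 * l - 1) * 2"
    using assms norm_triangle_ineq[of "cis s" "cis t"]
    by (intro mult_mono powr_mono2) (auto simp: cmod_cis_diff_le)
  finally show ?thesis by simp
qed simp

text \<open>The integrand is, up to the factor \<open>\<i>\<close>, the derivative of \<open>(1 - cis t) * h t * P t\<close>. The extra factor \<open>1 - cis t\<close>
cancels the pole at \<open>cis t = 1\<close> of the logarithmic derivative of \<open>h\<close>, and it keeps the function continuous at
\<open>cis t = 1\<close> even for \<open>a = 0\<close>, where \<open>0 powr 0 = 0\<close> can make \<open>h\<close> itself jump.\<close>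

lemma integral_by_parts_angle:
  fixes w :: "'i \<Rightarrow> real" and e :: nat
  assumes fin: "finite I" and a: "a \<ge> 0" and l: "l \<ge> 1 / 2"
  defines "P \<equiv> \<lambda>t. \<Prod>i\<in>I. complex_of_real (cmod (cis t - cis (w i)) powr (2 * l))"
    and "h \<equiv> \<lambda>t. complex_of_real (cmod (1 - cis t) powr (2 * a)) * (1 - cis (- t)) ^ e"
  shows "(\<integral>t. h t * P t * (of_real (1 + a) * (1 - cis t) - of_real (1 + 2 * a + real e)
           + (\<Sum>i\<in>I. of_real l * ((cis t + cis (w i)) / (cis t - cis (w i)))) * (1 - cis t)) \<partial>angle_measure) = 0"
    (is "(\<integral>t. ?g t \<partial>angle_measure) = 0")
proof -
  define S where "S = {t \<in> {-pi..pi}. cis t = 1} \<union> (\<Union>i\<in>I. {t \<in> {-pi..pi}. cis t = cis (w i)})"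
  define f where "f t = (1 - cis t) * h t * P t" for t
  define Q where "Q t = (\<Sum>i\<in>I. of_real l * ((cis t + cis (w i)) / (cis t - cis (w i))))" for t
  have Pder: "(P has_vector_derivative P t * (\<i> * Q t)) (at t)"
    if "\<And>i. i \<in> I \<Longrightarrow> cis t \<noteq> cis (w i)" for t
    using fin that unfolding P_def Q_def
  proof (induction I)
    case (insert i I)
    then have IH: "((\<lambda>t. \<Prod>i\<in>I. complex_of_real (cmod (cis t - cis (w i)) powr (2 * l))) has_vector_derivative
        (\<Prod>i\<in>I. complex_of_real (cmod (cis t - cis (w i)) powr (2 * l))) *
        (\<i> * (\<Sum>i\<in>I. of_real l * ((cis t + cis (w i)) / (cis t - cis (w i)))))) (at t)" by auto
    have d: "((\<lambda>t. complex_of_real (cmod (cis t - cis (w i)) powr (2 * l))) has_vector_derivative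
      complex_of_real (cmod (cis t - cis (w i)) powr (2 * l)) * (of_real l * (\<i> * (cis t + cis (w i)) / (cis t - cis (w i))))) (at t)"
      using insert by (intro has_vector_derivative_cmod_cis_diff_powr) auto
    show ?case
      using has_vector_derivative_mult[OF d IH] insert(1,2) by (simp add: algebra_simps)
  qed auto
  have hder: "((\<lambda>t. (1 - cis t) * h t) has_vector_derivative
      \<i> * h t * (of_real (1 + a) * (1 - cis t) - of_real (1 + 2 * a + real e))) (at t)" if t: "cis t \<noteq> 1" for t
  proof -
    define u where "u = 1 - cis t"
    define v where "v = cis (- t)"
    have v: "v = 1 / cis t" by (simp add: v_def divide_inverse flip: cis_inverse)
    have d1: "((\<lambda>t. complex_of_real (cmod (1 - cis t) powr (2 * a))) has_vector_derivative
      complex_of_real (cmod (1 - cis t) powr (2 * a)) * (of_real a * (\<i> * (cis t + 1) / (cis t - 1)))) (at t)"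
      using has_vector_derivative_cmod_cis_diff_powr[of t 0 a] t by (simp add: norm_minus_commute)
    have d2: "((\<lambda>t. 1 - cis t) has_vector_derivative - (\<i> * cis t)) (at t)"
      unfolding cis_conv_exp by (auto intro!: derivative_eq_intros)
    have d3: "((\<lambda>t. 1 - cis (- t)) has_vector_derivative \<i> * v) (at t)"
      using has_vector_derivative_cnj[OF d2] by (simp add: cis_cnj v_def)
    have d4: "((\<lambda>t. (1 - cis (- t)) ^ e) has_vector_derivative \<i> * v * (of_nat e * (1 - v) ^ (e - 1))) (at t)"
    proof -
      have "((\<lambda>x. x ^ e) has_field_derivative of_nat e * (1 - cis (- t)) ^ (e - 1)) (at (1 - cis (- t)))"
        by (auto intro!: derivative_eq_intros)
      from field_vector_diff_chain_at[OF d3 this] show ?thesis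
        by (simp add: o_def v_def)
    qed
    have key: "(1 - cis t) * (\<i> * v * (of_nat e * (1 - v) ^ (e - 1))) = - (\<i> * of_nat e * (1 - v) ^ e)"
    proof (cases e)
      case (Suc m)
      have "(1 - cis t) * v = - (1 - v)" by (simp add: v field_simps)
      then have "(1 - cis t) * v * (\<i> * (of_nat e * (1 - v) ^ m)) = - (1 - v) * (\<i> * (of_nat e * (1 - v) ^ m))"
        by simp
      moreover have "(1 - cis t) * (\<i> * v * (of_nat e * (1 - v) ^ m)) = (1 - cis t) * v * (\<i> * (of_nat e * (1 - v) ^ m))"
        by (simp only: mult_ac)
      moreover have "- (1 - v) * (\<i> * (of_nat e * (1 - v) ^ m)) = - (\<i> * of_nat e * (1 - v) ^ Suc m)"
        unfolding power_Suc by (simp only: mult_ac mult_minus_left mult_minus_right)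
      ultimately show ?thesis by (simp only: Suc diff_Suc_1)
    qed simp
    have d5: "((\<lambda>t. (1 - cis t) * complex_of_real (cmod (1 - cis t) powr (2 * a))) has_vector_derivative
      complex_of_real (cmod (1 - cis t) powr (2 * a)) * (\<i> * (of_real (1 + a) * (1 - cis t) - of_real (1 + 2 * a)))) (at t)"
    proof -
      define K where "K = of_real a * (\<i> * (cis t + 1) / (cis t - 1))"
      have "(1 - cis t) * K = - (of_real a * (\<i> * (cis t + 1)))"
        unfolding K_def using t by (simp add: divide_simps) (simp add: algebra_simps)
      then have KX: "X * ((1 - cis t) * K) = X * - (of_real a * (\<i> * (cis t + 1)))" for X
        by simp
      have "(1 - cis t) * (X * K) + - (\<i> * cis t) * X =
         X * (\<i> * (of_real (1 + a) * (1 - cis t) - of_real (1 + 2 * a)))" for X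
        using KX[of X] by (simp add: algebra_simps)
      with has_vector_derivative_mult[OF d2 d1[folded K_def]] show ?thesis by simp
    qed
    have "((\<lambda>t. (1 - cis t) * h t) has_vector_derivative
       ((1 - cis t) * complex_of_real (cmod (1 - cis t) powr (2 * a))) * (\<i> * v * (of_nat e * (1 - v) ^ (e - 1)))
       + complex_of_real (cmod (1 - cis t) powr (2 * a)) * (\<i> * (of_real (1 + a) * (1 - cis t) - of_real (1 + 2 * a))) * (1 - v) ^ e) (at t)"
      using has_vector_derivative_mult[OF d5 d4] by (simp add: h_def mult.assoc v_def)
    moreover have "((1 - cis t) * X) * (\<i> * v * (of_nat e * (1 - v) ^ (e - 1)))
       + X * (\<i> * (of_real (1 + a) * (1 - cis t) - of_real (1 + 2 * a))) * (1 - v) ^ e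
       = \<i> * (X * (1 - v) ^ e) * (of_real (1 + a) * (1 - cis t) - of_real (1 + 2 * a + real e))" for X
    proof -
      have "((1 - cis t) * X) * (\<i> * v * (of_nat e * (1 - v) ^ (e - 1))) = X * ((1 - cis t) * (\<i> * v * (of_nat e * (1 - v) ^ (e - 1))))"
        by simp
      also have "\<dots> = - (X * (\<i> * of_nat e * (1 - v) ^ e))" unfolding key by simp
      finally show ?thesis by (simp add: algebra_simps)
    qed
    ultimately show ?thesis by (simp add: h_def v_def)
  qed
  have "(\<integral>t. \<i> * ?g t \<partial>angle_measure) = 0"
  proof (rule integral_periodic_derivative_eq_0[where S = S and f = f])
    show "finite S" unfolding S_def using fin finite_cis_preimage by auto
    have "cis (-pi) = -1" by (simp add: complex_eq_iff)
    then show "f (-pi) = f pi" by (simp add: f_def h_def P_def)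
    show "(f has_vector_derivative \<i> * ?g t) (at t)" if "t \<in> {-pi<..<pi} - S" for t
    proof -
      from that have "cis t \<noteq> 1" "\<And>i. i \<in> I \<Longrightarrow> cis t \<noteq> cis (w i)"
        by (auto simp: S_def)
      from has_vector_derivative_mult[OF hder[OF this(1)] Pder[OF this(2)]]
      show ?thesis unfolding f_def Q_def[symmetric]
        by (simp add: algebra_simps)
    qed
    show "continuous_on {-pi..pi} f"
    proof -
      have c: "continuous_on {-pi..pi} (\<lambda>t. (1 - cis t) * complex_of_real (cmod (1 - cis t) powr (2 * a)))"
      proof (cases "a = 0")
        case True
        then have "(\<lambda>t. (1 - cis t) * complex_of_real (cmod (1 - cis t) powr (2 * a))) = (\<lambda>t. 1 - cis t)"
          by (auto simp: fun_eq_iff)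
        then show ?thesis by (simp only:) (intro continuous_intros)
      next
        case False
        with a show ?thesis by (intro continuous_intros continuous_on_powr') auto
      qed
      have cP: "continuous_on {-pi..pi} P"
        unfolding P_def using l by (intro continuous_intros continuous_on_powr') auto
      have "continuous_on {-pi..pi} (\<lambda>t. ((1 - cis t) * complex_of_real (cmod (1 - cis t) powr (2 * a))) * (1 - cis (- t)) ^ e * P t)"
        by (intro continuous_intros c cP)
      then show ?thesis by (simp add: f_def[abs_def] h_def mult.assoc)
    qed
    show "(\<lambda>t. \<i> * ?g t) \<in> borel_measurable borel"
      unfolding h_def P_def by measurable
    define B where "B = 2 powr (2 * a) * 2 ^ e"
    define C where "C = (2 powr (2 * l)) ^ card I"
    define D where "D = (2 powr (2 * l)) ^ (card I - 1)"
    show "cmod (\<i> * ?g t) \<le> B * (C * (2 * (1 + a) + (1 + 2 * a + real e)) + card I * (l * (D * (2 * 2 powr (2 * l - 1)))) * 2)" for t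
    proof -
      have u: "cmod (1 - cis t) \<le> 2" by (rule cmod_one_minus_cis_le)
      have hb: "cmod (h t) \<le> B"
        unfolding h_def B_def norm_mult norm_power norm_of_real abs_of_nonneg[OF powr_ge_zero]
        using a u cmod_one_minus_cis_le[of "-t"]
        by (intro mult_mono power_mono) (auto intro!: powr_mono2)
      have fb: "cmod (cis t - cis (w i)) powr (2 * l) \<le> 2 powr (2 * l)" for i
        using l by (intro powr_mono2) (auto simp: cmod_cis_diff_le)
      have Pb: "cmod (\<Prod>i\<in>J. complex_of_real (cmod (cis t - cis (w i)) powr (2 * l))) \<le> (2 powr (2 * l)) ^ card J" for J
      proof -
        have "cmod (\<Prod>i\<in>J. complex_of_real (cmod (cis t - cis (w i)) powr (2 * l))) \<le> (\<Prod>i\<in>J. 2 powr (2 * l))"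
          unfolding prod_norm[symmetric] using fb by (intro prod_mono) auto
        then show ?thesis by simp
      qed
      have Qb: "cmod (P t * Q t) \<le> card I * (l * (D * (2 * 2 powr (2 * l - 1))))"
      proof -
        have PQ: "P t * Q t = (\<Sum>i\<in>I. of_real l * ((\<Prod>j\<in>I - {i}. complex_of_real (cmod (cis t - cis (w j)) powr (2 * l)))
           * (of_real (cmod (cis t - cis (w i)) powr (2 * l)) * ((cis t + cis (w i)) / (cis t - cis (w i))))))"
          unfolding Q_def sum_distrib_left P_def
          by (intro sum.cong refl, subst prod.remove[OF fin]) (auto simp: algebra_simps)
        have "cmod (P t * Q t) \<le> (\<Sum>i\<in>I. l * (D * (2 * 2 powr (2 * l - 1))))"
          unfolding PQ
        proof (intro sum_norm_le)
          fix i assume "i \<in> I"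
          then have "card (I - {i}) = card I - 1" using fin by simp
          then have "cmod (\<Prod>j\<in>I - {i}. complex_of_real (cmod (cis t - cis (w j)) powr (2 * l))) \<le> D"
            using Pb[of "I - {i}"] by (simp add: D_def)
          moreover have "cmod (of_real l) = l" using l by simp
          ultimately show "cmod (of_real l * ((\<Prod>j\<in>I - {i}. complex_of_real (cmod (cis t - cis (w j)) powr (2 * l)))
           * (of_real (cmod (cis t - cis (w i)) powr (2 * l)) * ((cis t + cis (w i)) / (cis t - cis (w i))))))
            \<le> l * (D * (2 * 2 powr (2 * l - 1)))"
            unfolding norm_mult[of "of_real l"] norm_mult[of "prod _ _"]
            using l powr_mult_cot_bound[OF l, of t "w i"]
            by (intro mult_mono) (auto simp: D_def)
        qed
        then show ?thesis by simp
      qed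
      have "cmod (of_real (1 + a) * (1 - cis t) - of_real (1 + 2 * a + real e)) \<le> cmod (of_real (1 + a) * (1 - cis t)) + cmod (of_real (1 + 2 * a + real e))"
        by (rule norm_triangle_ineq4)
      also have "\<dots> \<le> 2 * (1 + a) + (1 + 2 * a + real e)"
        unfolding norm_mult norm_of_real using a u mult_left_mono[OF u, of "1 + a"] by (simp add: algebra_simps)
      finally have lb: "cmod (of_real (1 + a) * (1 - cis t) - of_real (1 + 2 * a + real e)) \<le> 2 * (1 + a) + (1 + 2 * a + real e)" .
      have gt: "\<i> * ?g t = \<i> * (h t * (P t * (of_real (1 + a) * (1 - cis t) - of_real (1 + 2 * a + real e)) + (P t * Q t) * (1 - cis t)))"
        by (simp add: Q_def algebra_simps)
      have "cmod (\<i> * ?g t) = cmod (h t) * cmod (P t * (of_real (1 + a) * (1 - cis t) - of_real (1 + 2 * a + real e)) + (P t * Q t) * (1 - cis t))"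
        unfolding gt by (simp only: norm_mult norm_ii mult_1_left)
      also have "\<dots> \<le> B * (C * (2 * (1 + a) + (1 + 2 * a + real e)) + card I * (l * (D * (2 * 2 powr (2 * l - 1)))) * 2)"
      proof (intro mult_mono hb order_trans[OF norm_triangle_ineq] add_mono)
        show "cmod (P t * (of_real (1 + a) * (1 - cis t) - of_real (1 + 2 * a + real e))) \<le> C * (2 * (1 + a) + (1 + 2 * a + real e))"
        proof -
          have "cmod (P t) \<le> C" using Pb[of I] by (simp only: C_def P_def)
          then show ?thesis unfolding norm_mult[of "P t"] using lb by (intro mult_mono) (auto simp: C_def)
        qed
        show "cmod (P t * Q t * (1 - cis t)) \<le> card I * (l * (D * (2 * 2 powr (2 * l - 1)))) * 2"
          unfolding norm_mult[of "P t * Q t"] using Qb u l by (intro mult_mono) (auto simp: D_def)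
      qed (auto simp: B_def)
      finally show ?thesis .
    qed
  qed
  then show ?thesis by simp
qed

section \<open>Aomoto's recursion on the circle\<close>

text \<open>Every unordered pair occurs twice, so exponent \<open>l\<close> here means exponent \<open>2 * l\<close> per pair. In this form the index type
needs no order, and invariance under permutations is a reindexing.\<close>

definition vandermonde :: "real \<Rightarrow> 'i set \<Rightarrow> ('i \<Rightarrow> real) \<Rightarrow> real" where
  "vandermonde l I \<theta> = (\<Prod>i\<in>I. \<Prod>j\<in>I - {i}. cmod (cis (\<theta> i) - cis (\<theta> j)) powr l)"

text \<open>The exponents of \<open>1 - z\<close> and of its conjugate are \<open>a\<close> and \<open>a + e\<close>. The step from \<open>a\<close> to \<open>a + 1\<close> raises them one after the
other, so it passes through a complex weight, with \<open>e = 1\<close>.\<close>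

definition one_body_weight :: "real \<Rightarrow> nat \<Rightarrow> real \<Rightarrow> complex" where
  "one_body_weight a e t = of_real (cmod (1 - cis t) powr (2 * a)) * (1 - cis (- t)) ^ e"

definition morris_weight :: "real \<Rightarrow> real \<Rightarrow> nat \<Rightarrow> 'i set \<Rightarrow> ('i \<Rightarrow> real) \<Rightarrow> complex" where
  "morris_weight l a e I \<theta> = of_real (vandermonde l I \<theta>) * (\<Prod>j\<in>I. one_body_weight a e (\<theta> j))"

lemma vandermonde_nonneg: "vandermonde l I \<theta> \<ge> 0"
  unfolding vandermonde_def by (intro prod_nonneg ballI) auto

lemma vandermonde_cong:
  "(\<And>i. i \<in> I \<Longrightarrow> \<theta> i = \<theta>' i) \<Longrightarrow> vandermonde l I \<theta> = vandermonde l I \<theta>'"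
  unfolding vandermonde_def by (intro prod.cong) auto

lemma vandermonde_insert:
  assumes "finite I" "p \<notin> I"
  shows "vandermonde l (insert p I) \<theta>
       = vandermonde l I \<theta> * (\<Prod>i\<in>I. cmod (cis (\<theta> p) - cis (\<theta> i)) powr (2 * l))"
proof -
  have "(\<Prod>j\<in>insert p I - {i}. cmod (cis (\<theta> i) - cis (\<theta> j)) powr l)
      = cmod (cis (\<theta> p) - cis (\<theta> i)) powr l * (\<Prod>j\<in>I - {i}. cmod (cis (\<theta> i) - cis (\<theta> j)) powr l)" if "i \<in> I" for i
  proof -
    have "insert p I - {i} = insert p (I - {i})" using assms that by auto
    then show ?thesis using assms by (simp add: norm_minus_commute)
  qed
  moreover have "insert p I - {p} = I" using assms by auto
  ultimately have "vandermonde l (insert p I) \<theta> = (\<Prod>i\<in>I. cmod (cis (\<theta> p) - cis (\<theta> i)) powr l)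
      * ((\<Prod>i\<in>I. cmod (cis (\<theta> p) - cis (\<theta> i)) powr l) * vandermonde l I \<theta>)"
    using assms by (simp add: vandermonde_def prod.distrib)
  also have "\<dots> = vandermonde l I \<theta> * (\<Prod>i\<in>I. cmod (cis (\<theta> p) - cis (\<theta> i)) powr l * cmod (cis (\<theta> p) - cis (\<theta> i)) powr l)"
    by (simp add: prod.distrib)
  finally show ?thesis by (simp flip: powr_add)
qed

lemma vandermonde_permute:
  assumes "bij_betw \<sigma> I I"
  shows "vandermonde l I (\<lambda>k\<in>I. \<theta> (\<sigma> k)) = vandermonde l I \<theta>"
proof -
  have "vandermonde l I (\<lambda>k\<in>I. \<theta> (\<sigma> k))
      = (\<Prod>i\<in>I. \<Prod>j\<in>I - {i}. cmod (cis (\<theta> (\<sigma> i)) - cis (\<theta> (\<sigma> j))) powr l)"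
    unfolding vandermonde_def by (intro prod.cong) auto
  also have "\<dots> = (\<Prod>i\<in>I. \<Prod>j\<in>I - {\<sigma> i}. cmod (cis (\<theta> (\<sigma> i)) - cis (\<theta> j)) powr l)"
  proof (rule prod.cong[OF refl])
    fix i assume "i \<in> I"
    then have "bij_betw \<sigma> (I - {i}) (I - {\<sigma> i})"
      using assms by (auto simp: bij_betw_def inj_on_def)
    from prod.reindex_bij_betw[OF this, of "\<lambda>j. cmod (cis (\<theta> (\<sigma> i)) - cis (\<theta> j)) powr l"]
    show "(\<Prod>j\<in>I - {i}. cmod (cis (\<theta> (\<sigma> i)) - cis (\<theta> (\<sigma> j))) powr l)
        = (\<Prod>j\<in>I - {\<sigma> i}. cmod (cis (\<theta> (\<sigma> i)) - cis (\<theta> j)) powr l)" by simp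
  qed
  also have "\<dots> = vandermonde l I \<theta>"
    unfolding vandermonde_def
    by (rule prod.reindex_bij_betw[OF assms, of "\<lambda>i. \<Prod>j\<in>I - {i}. cmod (cis (\<theta> i) - cis (\<theta> j)) powr l"])
  finally show ?thesis .
qed

lemma morris_weight_permute:
  assumes "bij_betw \<sigma> I I"
  shows "morris_weight l a e I (\<lambda>k\<in>I. \<theta> (\<sigma> k)) = morris_weight l a e I \<theta>"
  unfolding morris_weight_def vandermonde_permute[OF assms]
  using prod.reindex_bij_betw[OF assms, of "\<lambda>k. one_body_weight a e (\<theta> k)"] by simp

lemma angle_coordinate_measurable [measurable]:
  "i \<in> I \<Longrightarrow> (\<lambda>\<theta>. \<theta> i) \<in> borel_measurable (angles I)"
  using measurable_component_singleton[of i I "\<lambda>_. angle_measure"] by (simp cong: measurable_cong_sets)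

lemma complex_of_real_measurable:
  "f \<in> borel_measurable M \<Longrightarrow> (\<lambda>x. complex_of_real (f x)) \<in> borel_measurable M"
  by (rule measurable_compose[OF _ borel_measurable_of_real])

lemma cmod_measurable: "f \<in> borel_measurable M \<Longrightarrow> (\<lambda>x. cmod (f x)) \<in> borel_measurable M"
  by (rule measurable_compose[OF _ borel_measurable_norm])

lemma vandermonde_measurable [measurable]: "vandermonde l I \<in> borel_measurable (angles I)"
  unfolding vandermonde_def[abs_def]
  by (intro borel_measurable_prod powr_real_measurable borel_measurable_const cmod_measurable borel_measurable_diff
      cis_measurable angle_coordinate_measurable) auto

lemma one_body_weight_measurable [measurable (raw)]:
  assumes [measurable]: "f \<in> borel_measurable M"
  shows "(\<lambda>x. one_body_weight a e (f x)) \<in> borel_measurable M"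
  unfolding one_body_weight_def
  by (intro borel_measurable_times complex_of_real_measurable borel_measurable_power powr_real_measurable borel_measurable_const
      cmod_measurable borel_measurable_diff borel_measurable_const cis_measurable borel_measurable_uminus assms)

lemma morris_weight_measurable [measurable]: "morris_weight l a e I \<in> borel_measurable (angles I)"
  unfolding morris_weight_def[abs_def]
  by (intro borel_measurable_times complex_of_real_measurable vandermonde_measurable borel_measurable_prod
      one_body_weight_measurable angle_coordinate_measurable)

lemma one_body_weight_bounded:
  assumes "a \<ge> 0"
  shows "cmod (one_body_weight a e t) \<le> 2 powr (2 * a) * 2 ^ e"
  unfolding one_body_weight_def norm_mult norm_power norm_of_real abs_of_nonneg[OF powr_ge_zero]
  using assms cmod_one_minus_cis_le[of t] cmod_one_minus_cis_le[of "-t"]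
  by (intro mult_mono power_mono) (auto intro!: powr_mono2)

lemma vandermonde_bounded:
  assumes "l \<ge> 0"
  obtains B where "B \<ge> 0" "\<And>\<theta>. vandermonde l I \<theta> \<le> B"
proof
  show "vandermonde l I \<theta> \<le> (\<Prod>i\<in>I. \<Prod>j\<in>I - {i}. 2 powr l)" for \<theta>
    unfolding vandermonde_def using assms
    by (intro prod_mono conjI prod_nonneg ballI powr_mono2 cmod_cis_diff_le) auto
qed (auto intro!: prod_nonneg)

lemma one_body_prod_bounded:
  assumes "a \<ge> 0"
  obtains B where "B \<ge> 0" "\<And>\<theta>. cmod (\<Prod>j\<in>I. one_body_weight a e (\<theta> j)) \<le> B"
proof
  show "cmod (\<Prod>j\<in>I. one_body_weight a e (\<theta> j)) \<le> (\<Prod>j\<in>I. 2 powr (2 * a) * 2 ^ e)" for \<theta>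
    unfolding prod_norm[symmetric]
    by (intro prod_mono conjI one_body_weight_bounded assms) auto
qed (auto intro!: prod_nonneg)

lemma morris_weight_bounded:
  assumes "l \<ge> 0" "a \<ge> 0"
  obtains B where "B \<ge> 0" "\<And>\<theta>. cmod (morris_weight l a e I \<theta>) \<le> B"
proof -
  obtain B1 where B1: "B1 \<ge> 0" "\<And>\<theta>. vandermonde l I \<theta> \<le> B1"
    using vandermonde_bounded[OF assms(1)] by metis
  obtain B2 where B2: "B2 \<ge> 0" "\<And>\<theta>. cmod (\<Prod>j\<in>I. one_body_weight a e (\<theta> j)) \<le> B2"
    using one_body_prod_bounded[OF assms(2)] by metis
  have "cmod (morris_weight l a e I \<theta>) \<le> B1 * B2" for \<theta>
    unfolding morris_weight_def norm_mult norm_of_real abs_of_nonneg[OF vandermonde_nonneg]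
    using B1 B2 by (intro mult_mono) auto
  with B1 B2 show ?thesis by (intro that[of "B1 * B2"]) auto
qed

text \<open>The factor \<open>(z p + z i) / (z p - z i)\<close> is unbounded, but its product with the weight is bounded
  because the weight contains \<open>\<bar>z p - z i\<bar> powr (2 * l)\<close> and \<open>2 * l \<ge> 1\<close>.\<close>

lemma morris_weight_cot_bounded:
  assumes fin: "finite I" and "p \<in> I" "i \<in> I" "i \<noteq> p" and l: "l \<ge> 1 / 2" and a: "a \<ge> 0"
  obtains B where "B \<ge> 0"
    "\<And>\<theta>. cmod (morris_weight l a e I \<theta> * ((cis (\<theta> p) + cis (\<theta> i)) / (cis (\<theta> p) - cis (\<theta> i)))) \<le> B"
proof -
  have l0: "l \<ge> 0" using l by simp
  define I' where "I' = I - {p}"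
  have I': "I = insert p I'" "finite I'" "p \<notin> I'" "i \<in> I'" using assms by (auto simp: I'_def)
  obtain B1 where B1: "B1 \<ge> 0" "\<And>\<theta>. vandermonde l I' \<theta> \<le> B1"
    using vandermonde_bounded[OF l0] by metis
  obtain B2 where B2: "B2 \<ge> 0" "\<And>\<theta>. cmod (\<Prod>j\<in>I. one_body_weight a e (\<theta> j)) \<le> B2"
    using one_body_prod_bounded[OF a] by metis
  define B3 where "B3 = (\<Prod>j\<in>I' - {i}. 2 powr (2 * l))"
  have B3: "(\<Prod>j\<in>I' - {i}. cmod (cis (\<theta> p) - cis (\<theta> j)) powr (2 * l)) \<le> B3" for \<theta>
    unfolding B3_def using l by (intro prod_mono conjI powr_mono2 cmod_cis_diff_le) auto
  have B3n: "B3 \<ge> 0" by (auto simp: B3_def intro!: prod_nonneg)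
  have "cmod (morris_weight l a e I \<theta> * ((cis (\<theta> p) + cis (\<theta> i)) / (cis (\<theta> p) - cis (\<theta> i))))
      \<le> B1 * B3 * B2 * (2 * 2 powr (2 * l - 1))" for \<theta>
  proof -
    define V where "V = vandermonde l I' \<theta>"
    define R where "R = (\<Prod>j\<in>I' - {i}. cmod (cis (\<theta> p) - cis (\<theta> j)) powr (2 * l))"
    define Ob where "Ob = (\<Prod>j\<in>I. one_body_weight a e (\<theta> j))"
    define x where "x = cmod (cis (\<theta> p) - cis (\<theta> i)) powr (2 * l)"
    define c where "c = (cis (\<theta> p) + cis (\<theta> i)) / (cis (\<theta> p) - cis (\<theta> i))"
    have "vandermonde l I \<theta> = V * (x * R)"
      unfolding I'(1) vandermonde_insert[OF I'(2,3)] V_def x_def R_def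
      by (subst prod.remove[OF I'(2,4)]) simp
    then have "morris_weight l a e I \<theta> * c = of_real V * of_real R * Ob * (of_real x * c)"
      by (simp add: morris_weight_def Ob_def)
    then have "cmod (morris_weight l a e I \<theta> * c) = V * R * cmod Ob * cmod (of_real x * c)"
    proof -
      have "V \<ge> 0" "R \<ge> 0" by (auto simp: V_def R_def vandermonde_nonneg intro!: prod_nonneg)
      with \<open>morris_weight l a e I \<theta> * c = _\<close> show ?thesis by (simp only: norm_mult norm_of_real abs_of_nonneg)
    qed
    also have "\<dots> \<le> B1 * B3 * B2 * (2 * 2 powr (2 * l - 1))"
      using B1 B2 B3n B3[of \<theta>] powr_mult_cot_bound[OF l, of "\<theta> p" "\<theta> i"]
      unfolding V_def R_def Ob_def x_def c_def
      by (intro mult_mono) (auto intro!: mult_nonneg_nonneg prod_nonneg vandermonde_nonneg)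
    finally show ?thesis by (simp only: c_def)
  qed
  with B1 B2 B3n show ?thesis
    by (intro that[of "B1 * B3 * B2 * (2 * 2 powr (2 * l - 1))"]) auto
qed

definition aomoto_moment :: "real \<Rightarrow> real \<Rightarrow> nat \<Rightarrow> 'i set \<Rightarrow> 'i set \<Rightarrow> complex" where
  "aomoto_moment l a e I J = (\<integral>\<theta>. morris_weight l a e I \<theta> * (\<Prod>j\<in>J. 1 - cis (\<theta> j)) \<partial>angles I)"

definition cot_moment :: "real \<Rightarrow> real \<Rightarrow> nat \<Rightarrow> 'i set \<Rightarrow> 'i \<Rightarrow> 'i \<Rightarrow> 'i set \<Rightarrow> complex" where
  "cot_moment l a e I p i J = (\<integral>\<theta>. morris_weight l a e I \<theta> * ((cis (\<theta> p) + cis (\<theta> i)) / (cis (\<theta> p) - cis (\<theta> i)))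
      * (\<Prod>j\<in>J. 1 - cis (\<theta> j)) \<partial>angles I)"

lemma prod_one_minus_cis_bounded: "cmod (\<Prod>j\<in>J. 1 - cis (\<theta> j)) \<le> 2 ^ card J"
proof -
  have "cmod (\<Prod>j\<in>J. 1 - cis (\<theta> j)) \<le> (\<Prod>j\<in>J. 2)"
    unfolding prod_norm[symmetric] by (intro prod_mono conjI cmod_one_minus_cis_le) auto
  then show ?thesis by simp
qed

lemma prod_one_minus_cis_measurable [measurable]:
  "J \<subseteq> I \<Longrightarrow> (\<lambda>\<theta>. \<Prod>j\<in>J. 1 - cis (\<theta> j)) \<in> borel_measurable (angles I)"
  by (intro borel_measurable_prod borel_measurable_diff cis_measurable angle_coordinate_measurable) auto

lemma integrable_aomoto:
  assumes "J \<subseteq> I" "l \<ge> 0" "a \<ge> 0"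
  shows "integrable (angles I) (\<lambda>\<theta>. morris_weight l a e I \<theta> * (\<Prod>j\<in>J. 1 - cis (\<theta> j)))"
proof -
  obtain B where B: "B \<ge> 0" "\<And>\<theta>. cmod (morris_weight l a e I \<theta>) \<le> B"
    using morris_weight_bounded[OF assms(2,3)] by metis
  show ?thesis
  proof (rule integrable_angles[where B = "B * 2 ^ card J"])
    show "cmod (morris_weight l a e I \<theta> * (\<Prod>j\<in>J. 1 - cis (\<theta> j))) \<le> B * 2 ^ card J" for \<theta>
      unfolding norm_mult using B by (intro mult_mono prod_one_minus_cis_bounded) auto
  qed (use assms in measurable)
qed

lemma integrable_cot:
  assumes "finite I" "J \<subseteq> I" "p \<in> I" "i \<in> I" "i \<noteq> p" "l \<ge> 1 / 2" "a \<ge> 0"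
  shows "integrable (angles I) (\<lambda>\<theta>. morris_weight l a e I \<theta> * ((cis (\<theta> p) + cis (\<theta> i)) / (cis (\<theta> p) - cis (\<theta> i)))
      * (\<Prod>j\<in>J. 1 - cis (\<theta> j)))"
proof -
  obtain B where B: "B \<ge> 0" "\<And>\<theta>. cmod (morris_weight l a e I \<theta> * ((cis (\<theta> p) + cis (\<theta> i)) / (cis (\<theta> p) - cis (\<theta> i)))) \<le> B"
    using morris_weight_cot_bounded[OF assms(1,3,4,5,6,7)] by metis
  show ?thesis
  proof (rule integrable_angles[where B = "B * 2 ^ card J"])
    show "cmod (morris_weight l a e I \<theta> * ((cis (\<theta> p) + cis (\<theta> i)) / (cis (\<theta> p) - cis (\<theta> i))) * (\<Prod>j\<in>J. 1 - cis (\<theta> j))) \<le> B * 2 ^ card J" for \<theta>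
      unfolding norm_mult[of _ "prod _ _"] using B by (intro mult_mono prod_one_minus_cis_bounded) auto
  qed (use assms in measurable)
qed

text \<open>Fubini reduces this to the identity in the single angle \<open>\<theta> p\<close>; all factors without \<open>p\<close> are constants there.\<close>

lemma integral_by_parts_moments:
  assumes fin: "finite I" and J: "J \<subseteq> I" and p: "p \<in> J" and l: "l \<ge> 1 / 2" and a: "a \<ge> 0"
  shows "of_real (1 + a) * aomoto_moment l a e I J - of_real (1 + 2 * a + real e) * aomoto_moment l a e I (J - {p})
       + (\<Sum>i\<in>I - {p}. of_real l * cot_moment l a e I p i J) = 0"
proof -
  define I' where "I' = I - {p}"
  have I': "I = insert p I'" "finite I'" "p \<notin> I'" using assms by (auto simp: I'_def)
  have l0: "l \<ge> 0" using l by simp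
  define c where "c \<theta> i = (cis (\<theta> p) + cis (\<theta> i)) / (cis (\<theta> p) - cis (\<theta> i))" for \<theta> i
  define g where "g \<theta> = of_real (1 + a) * (morris_weight l a e I \<theta> * (\<Prod>j\<in>J. 1 - cis (\<theta> j)))
       - of_real (1 + 2 * a + real e) * (morris_weight l a e I \<theta> * (\<Prod>j\<in>J - {p}. 1 - cis (\<theta> j)))
       + (\<Sum>i\<in>I'. of_real l * (morris_weight l a e I \<theta> * c \<theta> i * (\<Prod>j\<in>J. 1 - cis (\<theta> j))))" for \<theta>
  note int1 = integrable_aomoto[OF J l0 a, of e]
  have int2: "integrable (angles I) (\<lambda>\<theta>. morris_weight l a e I \<theta> * (\<Prod>j\<in>J - {p}. 1 - cis (\<theta> j)))"
    using J by (intro integrable_aomoto l0 a) auto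
  have int3: "integrable (angles I) (\<lambda>\<theta>. morris_weight l a e I \<theta> * c \<theta> i * (\<Prod>j\<in>J. 1 - cis (\<theta> j)))"
    if "i \<in> I'" for i
    unfolding c_def using that fin J p l a by (intro integrable_cot) (auto simp: I'_def)
  have int: "integrable (angles I) g"
    unfolding g_def
    by (intro Bochner_Integration.integrable_add Bochner_Integration.integrable_diff
        Bochner_Integration.integrable_sum integrable_mult_right int1 int2 int3)
  have "(\<integral>\<theta>. g \<theta> \<partial>angles I) = of_real (1 + a) * aomoto_moment l a e I J - of_real (1 + 2 * a + real e) * aomoto_moment l a e I (J - {p})
       + (\<Sum>i\<in>I'. of_real l * cot_moment l a e I p i J)"
    unfolding g_def aomoto_moment_def cot_moment_def c_def[symmetric]
    by (subst Bochner_Integration.integral_add Bochner_Integration.integral_diff Bochner_Integration.integral_sum integral_mult_right;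
       (intro Bochner_Integration.integrable_add Bochner_Integration.integrable_diff
        Bochner_Integration.integrable_sum integrable_mult_right int1 int2 int3)?; simp?)+
  moreover have "(\<integral>\<theta>. g \<theta> \<partial>angles I) = (\<integral>x. (\<integral>t. g (x(p := t)) \<partial>angle_measure) \<partial>angles I')"
    using int unfolding I'(1) by (intro angle_prod.product_integral_insert I')
  moreover have "(\<integral>t. g (x(p := t)) \<partial>angle_measure) = 0" for x
  proof -
    define K where "K = of_real (vandermonde l I' x) * (\<Prod>j\<in>I'. one_body_weight a e (x j)) * (\<Prod>j\<in>J - {p}. 1 - cis (x j))"
    have "g (x(p := t)) = K * (one_body_weight a e t * (\<Prod>i\<in>I'. complex_of_real (cmod (cis t - cis (x i)) powr (2 * l)))
       * (of_real (1 + a) * (1 - cis t) - of_real (1 + 2 * a + real e)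
           + (\<Sum>i\<in>I'. of_real l * ((cis t + cis (x i)) / (cis t - cis (x i)))) * (1 - cis t)))" for t
    proof -
      define y where "y = x(p := t)"
      have y: "y p = t" "\<And>i. i \<in> I' \<Longrightarrow> y i = x i" using I' by (auto simp: y_def)
      have v: "vandermonde l I' y = vandermonde l I' x" using y by (intro vandermonde_cong) auto
      have u: "(\<Prod>j\<in>J - {p}. 1 - cis (y j)) = (\<Prod>j\<in>J - {p}. 1 - cis (x j))"
        using J y by (intro prod.cong) (auto simp: I'_def)
      have uJ: "(\<Prod>j\<in>J. 1 - cis (y j)) = (1 - cis t) * (\<Prod>j\<in>J - {p}. 1 - cis (x j))"
        using prod.remove[OF finite_subset[OF J fin] p, of "\<lambda>j. 1 - cis (y j)"] u y by simp
      define Ob where "Ob = one_body_weight a e t"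
      define P where "P = (\<Prod>i\<in>I'. complex_of_real (cmod (cis t - cis (x i)) powr (2 * l)))"
      have w: "morris_weight l a e I y * (\<Prod>j\<in>J - {p}. 1 - cis (x j)) = K * (Ob * P)"
        unfolding morris_weight_def I'(1) vandermonde_insert[OF I'(2,3)]
        using I'(2,3) y by (simp add: v K_def Ob_def P_def)
      have cy: "c y i = (cis t + cis (x i)) / (cis t - cis (x i))" if "i \<in> I'" for i
        using that y by (simp add: c_def)
      define Q where "Q = (\<Sum>i\<in>I'. of_real l * c y i)"
      have "g y = (morris_weight l a e I y * (\<Prod>j\<in>J - {p}. 1 - cis (x j))) *
          (of_real (1 + a) * (1 - cis t) - of_real (1 + 2 * a + real e) + Q * (1 - cis t))"
        unfolding g_def u uJ Q_def sum_distrib_left sum_distrib_right distrib_left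
        by (intro arg_cong2[where f = "(+)"] sum.cong) (simp_all add: algebra_simps)
      also have "Q = (\<Sum>i\<in>I'. of_real l * ((cis t + cis (x i)) / (cis t - cis (x i))))"
        unfolding Q_def using cy by (intro sum.cong) auto
      finally have "g y = K * (Ob * P) * (of_real (1 + a) * (1 - cis t) - of_real (1 + 2 * a + real e)
           + (\<Sum>i\<in>I'. of_real l * ((cis t + cis (x i)) / (cis t - cis (x i)))) * (1 - cis t))"
        unfolding w .
      then show ?thesis by (simp only: mult.assoc y_def Ob_def P_def)
    qed
    then show ?thesis
      using integral_by_parts_angle[OF I'(2) a l, of e x]
      by (simp add: one_body_weight_def)
  qed
  ultimately show ?thesis by (simp add: I'_def)
qed

lemma bij_betw_transpose_self:
  assumes "p \<in> I" "i \<in> I"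
  shows "bij_betw (Transposition.transpose p i) I I"
  using assms by (intro bij_betw_byWitness[where f' = "Transposition.transpose p i"])
    (auto simp: Transposition.transpose_def)

lemma weighted_integral_swap:
  fixes \<phi> :: "('i \<Rightarrow> real) \<Rightarrow> complex"
  assumes "p \<in> I" "i \<in> I" and [measurable]: "\<phi> \<in> borel_measurable (angles I)"
  shows "(\<integral>\<theta>. morris_weight l a e I \<theta> * \<phi> (\<lambda>k\<in>I. \<theta> (Transposition.transpose p i k)) \<partial>angles I)
       = (\<integral>\<theta>. morris_weight l a e I \<theta> * \<phi> \<theta> \<partial>angles I)"
  using integral_angles_permute[OF bij_betw_transpose_self[OF assms(1,2)], of "\<lambda>\<theta>. morris_weight l a e I \<theta> * \<phi> \<theta>"]
  by (simp add: morris_weight_permute[OF bij_betw_transpose_self[OF assms(1,2)]])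

lemma aomoto_moment_exchange:
  assumes "J \<subseteq> I" "p \<in> J" "i \<in> I - J"
  shows "aomoto_moment l a e I (insert i (J - {p})) = aomoto_moment l a e I J"
proof -
  let ?\<sigma> = "Transposition.transpose p i"
  have "(\<Prod>j\<in>J. 1 - cis ((\<lambda>k\<in>I. \<theta> (?\<sigma> k)) j)) = (\<Prod>j\<in>insert i (J - {p}). 1 - cis (\<theta> j))" for \<theta> :: "_ \<Rightarrow> real"
  proof -
    have "bij_betw ?\<sigma> J (insert i (J - {p}))"
      using assms by (intro bij_betw_byWitness[where f' = ?\<sigma>]) (auto simp: Transposition.transpose_def)
    from prod.reindex_bij_betw[OF this, of "\<lambda>j. 1 - cis (\<theta> j)"] show ?thesis
      using assms by (auto simp: subset_iff intro!: prod.cong)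
  qed
  with weighted_integral_swap[of p I i "\<lambda>\<theta>. \<Prod>j\<in>J. 1 - cis (\<theta> j)" l a e] show ?thesis
    using assms by (auto simp: aomoto_moment_def)
qed

text \<open>Exchanging \<open>p\<close> and \<open>i\<close> fixes the weight and the product over \<open>J\<close> and changes the sign of the kernel.\<close>

lemma cot_moment_inside:
  assumes "J \<subseteq> I" "p \<in> J" "i \<in> J"
  shows "cot_moment l a e I p i J = 0"
proof -
  let ?\<sigma> = "Transposition.transpose p i"
  have pi: "p \<in> I" "i \<in> I" using assms by auto
  define \<phi> where "\<phi> \<theta> = (cis (\<theta> p) + cis (\<theta> i)) / (cis (\<theta> p) - cis (\<theta> i)) * (\<Prod>j\<in>J. 1 - cis (\<theta> j))" for \<theta> :: "_ \<Rightarrow> real"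
  have meas: "\<phi> \<in> borel_measurable (angles I)"
    unfolding \<phi>_def using pi assms by measurable
  have "\<phi> (\<lambda>k\<in>I. \<theta> (?\<sigma> k)) = - \<phi> \<theta>" for \<theta>
  proof -
    have "(\<Prod>j\<in>J. 1 - cis ((\<lambda>k\<in>I. \<theta> (?\<sigma> k)) j)) = (\<Prod>j\<in>J. 1 - cis (\<theta> j))"
      using prod.reindex_bij_betw[OF bij_betw_transpose_self[OF assms(2,3)], of "\<lambda>j. 1 - cis (\<theta> j)"] assms
      by (auto simp: subset_iff intro!: prod.cong)
    moreover have "(cis (\<theta> i) + cis (\<theta> p)) / (cis (\<theta> i) - cis (\<theta> p)) = - ((cis (\<theta> p) + cis (\<theta> i)) / (cis (\<theta> p) - cis (\<theta> i)))"
      by (simp add: add.commute minus_divide_right)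
    ultimately show ?thesis using pi by (simp add: \<phi>_def)
  qed
  then have "(\<integral>\<theta>. morris_weight l a e I \<theta> * - \<phi> \<theta> \<partial>angles I) = (\<integral>\<theta>. morris_weight l a e I \<theta> * \<phi> \<theta> \<partial>angles I)"
    using weighted_integral_swap[OF pi meas, of l a e] by simp
  then have "(\<integral>\<theta>. morris_weight l a e I \<theta> * \<phi> \<theta> \<partial>angles I) = 0"
    by simp
  then show ?thesis
    by (simp add: cot_moment_def \<phi>_def mult.assoc)
qed

text \<open>Exchanging \<open>p\<close> and \<open>i\<close> turns \<open>u p\<close> into \<open>u i\<close>, where \<open>u j = 1 - z j\<close>, and changes the sign of the kernel. In the average
of the two expressions the factor \<open>u p - u i = - (z p - z i)\<close> cancels the denominator and leaves
\<open>- (z p + z i) / 2 = (u p + u i) / 2 - 1\<close>.\<close>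

lemma cot_moment_outside:
  assumes fin: "finite I" and J: "J \<subseteq> I" and p: "p \<in> J" and i: "i \<in> I - J" and l: "l \<ge> 1 / 2" and a: "a \<ge> 0"
  shows "cot_moment l a e I p i J = aomoto_moment l a e I J - aomoto_moment l a e I (J - {p})"
proof -
  let ?\<sigma> = "Transposition.transpose p i"
  have pi: "p \<in> I" "i \<in> I" "p \<noteq> i" using assms by auto
  have finJ: "finite J" using J fin by (rule finite_subset)
  define J' where "J' = J - {p}"
  have J': "J' \<subseteq> I" "p \<notin> J'" "i \<notin> J'" "J = insert p J'" "finite J'" using J p i finJ by (auto simp: J'_def)
  define U where "U \<theta> = (\<Prod>j\<in>J'. 1 - cis (\<theta> j))" for \<theta> :: "_ \<Rightarrow> real"
  have [measurable]: "U \<in> borel_measurable (angles I)" unfolding U_def using J' by measurable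
  define c where "c \<theta> = (cis (\<theta> p) + cis (\<theta> i)) / (cis (\<theta> p) - cis (\<theta> i))" for \<theta> :: "_ \<Rightarrow> real"
  define \<phi> where "\<phi> \<theta> = c \<theta> * (\<Prod>j\<in>J. 1 - cis (\<theta> j))" for \<theta>
  have \<phi>: "\<phi> \<theta> = c \<theta> * ((1 - cis (\<theta> p)) * U \<theta>)" for \<theta>
    unfolding \<phi>_def U_def J'(4) using J' by simp
  have meas: "\<phi> \<in> borel_measurable (angles I)"
    unfolding \<phi>_def c_def using pi J by measurable
  have sw: "\<phi> (\<lambda>k\<in>I. \<theta> (?\<sigma> k)) = - (c \<theta> * ((1 - cis (\<theta> i)) * U \<theta>))" for \<theta>
  proof -
    have "U (\<lambda>k\<in>I. \<theta> (?\<sigma> k)) = U \<theta>"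
      unfolding U_def using J' by (intro prod.cong) (auto simp: Transposition.transpose_def)
    moreover have "(cis (\<theta> i) + cis (\<theta> p)) / (cis (\<theta> i) - cis (\<theta> p)) = - ((cis (\<theta> p) + cis (\<theta> i)) / (cis (\<theta> p) - cis (\<theta> i)))"
      by (simp add: add.commute minus_divide_right)
    ultimately show ?thesis using pi by (simp add: \<phi> c_def)
  qed
  let ?W = "morris_weight l a e I"
  have q1: "cot_moment l a e I p i J = (\<integral>\<theta>. ?W \<theta> * \<phi> \<theta> \<partial>angles I)"
    by (simp add: cot_moment_def \<phi>_def c_def mult.assoc)
  have q2: "cot_moment l a e I p i J = (\<integral>\<theta>. ?W \<theta> * - (c \<theta> * ((1 - cis (\<theta> i)) * U \<theta>)) \<partial>angles I)"
    using weighted_integral_swap[OF pi(1,2) meas, of l a e] unfolding q1 sw by simp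
  have int1: "integrable (angles I) (\<lambda>\<theta>. ?W \<theta> * \<phi> \<theta>)"
    using integrable_cot[OF fin J pi(1,2) pi(3)[symmetric] l a, of e] by (simp add: \<phi>_def c_def mult.assoc)
  have int2: "integrable (angles I) (\<lambda>\<theta>. ?W \<theta> * - (c \<theta> * ((1 - cis (\<theta> i)) * U \<theta>)))"
  proof -
    have "(1 - cis (\<theta> i)) * U \<theta> = (\<Prod>j\<in>insert i J'. 1 - cis (\<theta> j))" for \<theta>
      unfolding U_def using J' by simp
    moreover have "insert i J' \<subseteq> I" using J' pi by auto
    ultimately show ?thesis
      using integrable_cot[OF fin _ pi(1,2) pi(3)[symmetric] l a, of "insert i J'" e] by (simp add: c_def mult.assoc)
  qed
  \<comment> \<open>When \<open>z p = z i\<close> the kernel is \<open>0\<close> by the convention \<open>x / 0 = 0\<close>, but the weight vanishes as well.\<close>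
  have pt: "?W \<theta> * \<phi> \<theta> + ?W \<theta> * - (c \<theta> * ((1 - cis (\<theta> i)) * U \<theta>))
      = ?W \<theta> * (\<Prod>j\<in>J. 1 - cis (\<theta> j)) + ?W \<theta> * (\<Prod>j\<in>insert i J'. 1 - cis (\<theta> j)) - 2 * (?W \<theta> * U \<theta>)" for \<theta>
  proof (cases "cis (\<theta> p) = cis (\<theta> i)")
    case True
    have "vandermonde l I \<theta> = 0"
      unfolding vandermonde_def using pi True fin by (intro prod_zero bexI[of _ p] bexI[of _ i]) auto
    then show ?thesis by (simp add: morris_weight_def)
  next
    case False
    have "\<phi> \<theta> + - (c \<theta> * ((1 - cis (\<theta> i)) * U \<theta>)) = - ((cis (\<theta> p) - cis (\<theta> i)) * c \<theta>) * U \<theta>"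
      unfolding \<phi> by (simp add: algebra_simps)
    also have "(cis (\<theta> p) - cis (\<theta> i)) * c \<theta> = cis (\<theta> p) + cis (\<theta> i)"
      using False by (simp add: c_def)
    also have "- (cis (\<theta> p) + cis (\<theta> i)) * U \<theta> = (1 - cis (\<theta> p)) * U \<theta> + (1 - cis (\<theta> i)) * U \<theta> - 2 * U \<theta>"
      by (simp add: algebra_simps)
    finally have "?W \<theta> * (\<phi> \<theta> + - (c \<theta> * ((1 - cis (\<theta> i)) * U \<theta>)))
       = ?W \<theta> * ((1 - cis (\<theta> p)) * U \<theta> + (1 - cis (\<theta> i)) * U \<theta> - 2 * U \<theta>)" by simp
    then show ?thesis
      unfolding J'(4) using J' by (simp add: U_def[symmetric] algebra_simps)
  qed
  have l0: "l \<ge> 0" using l by simp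
  have "2 * cot_moment l a e I p i J = (\<integral>\<theta>. ?W \<theta> * \<phi> \<theta> + ?W \<theta> * - (c \<theta> * ((1 - cis (\<theta> i)) * U \<theta>)) \<partial>angles I)"
    unfolding Bochner_Integration.integral_add[OF int1 int2] q1[symmetric] q2[symmetric] by simp
  also have "\<dots> = aomoto_moment l a e I J + aomoto_moment l a e I (insert i J') - 2 * aomoto_moment l a e I J'"
  proof -
    have i3: "integrable (angles I) (\<lambda>\<theta>. ?W \<theta> * (\<Prod>j\<in>insert i J'. 1 - cis (\<theta> j)))"
      using J' pi by (intro integrable_aomoto l0 a) auto
    have i4: "integrable (angles I) (\<lambda>\<theta>. ?W \<theta> * U \<theta>)"
      unfolding U_def using J' pi by (intro integrable_aomoto l0 a) auto
    show ?thesis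
      unfolding pt aomoto_moment_def U_def[symmetric]
      by (subst Bochner_Integration.integral_diff Bochner_Integration.integral_add,
          intro Bochner_Integration.integrable_add integrable_aomoto[OF J l0 a] i3,
          intro integrable_mult_right i4 i3)+ simp
  qed
  also have "aomoto_moment l a e I (insert i J') = aomoto_moment l a e I J"
    unfolding J'_def using aomoto_moment_exchange[OF J p i] .
  finally have "2 * (cot_moment l a e I p i J - (aomoto_moment l a e I J - aomoto_moment l a e I (J - {p}))) = 0"
    by (simp add: J'_def algebra_simps)
  then show ?thesis by (simp only: mult_eq_0_iff) simp
qed

text \<open>Of the remaining indices, those in \<open>J\<close> contribute nothing and each of the \<open>card I - card J\<close> others contributes the same
difference of two moments, which closes the recursion.\<close>

lemma aomoto_recursion:
  assumes fin: "finite I" and J: "J \<subseteq> I" and p: "p \<in> J" and l: "l \<ge> 1 / 2" and a: "a \<ge> 0"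
  shows "of_real (1 + a + l * real (card I - card J)) * aomoto_moment l a e I J
       = of_real (1 + 2 * a + real e + l * real (card I - card J)) * aomoto_moment l a e I (J - {p})"
proof -
  let ?T = "aomoto_moment l a e I"
  have finJ: "finite J" using J fin by (rule finite_subset)
  have "I - {p} = (J - {p}) \<union> (I - J)" using J p by auto
  then have "(\<Sum>i\<in>I - {p}. of_real l * cot_moment l a e I p i J)
      = (\<Sum>i\<in>J - {p}. of_real l * cot_moment l a e I p i J) + (\<Sum>i\<in>I - J. of_real l * cot_moment l a e I p i J)"
    using fin finJ by (simp only:) (intro sum.union_disjoint, auto)
  also have "(\<Sum>i\<in>J - {p}. of_real l * cot_moment l a e I p i J) = 0"
    using cot_moment_inside[OF J p] by simp
  also have "(\<Sum>i\<in>I - J. of_real l * cot_moment l a e I p i J) = (\<Sum>i\<in>I - J. of_real l * (?T J - ?T (J - {p})))"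
    using cot_moment_outside[OF fin J p _ l a] by (intro sum.cong) auto
  also have "\<dots> = of_nat (card I - card J) * (of_real l * (?T J - ?T (J - {p})))"
    using card_Diff_subset[OF finJ J] by simp
  finally have S: "(\<Sum>i\<in>I - {p}. of_real l * cot_moment l a e I p i J)
      = of_nat (card I - card J) * (of_real l * (?T J - ?T (J - {p})))" by simp
  show ?thesis
    using integral_by_parts_moments[OF fin J p l a, of e] unfolding S by (simp add: algebra_simps)
qed

lemma aomoto_moment_eq:
  assumes fin: "finite I" and J: "J \<subseteq> I" and l: "l \<ge> 1 / 2" and a: "a \<ge> 0"
  shows "aomoto_moment l a e I J
       = of_real (\<Prod>r<card J. (1 + 2 * a + real e + l * real (card I - Suc r)) / (1 + a + l * real (card I - Suc r)))
         * aomoto_moment l a e I {}"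
proof -
  have "finite J" using J fin by (rule finite_subset)
  then show ?thesis using J
  proof (induction J)
    case (insert p J)
    let ?d = "real (card I - Suc (card J))"
    have pos: "1 + a + l * ?d > 0" using l a by (intro add_pos_nonneg mult_nonneg_nonneg) auto
    have "of_real (1 + a + l * ?d) * aomoto_moment l a e I (insert p J)
        = of_real (1 + 2 * a + real e + l * ?d) * aomoto_moment l a e I J"
      using aomoto_recursion[OF fin insert.prems, of p l a e] l a insert.hyps by simp
    then have "aomoto_moment l a e I (insert p J)
        = of_real ((1 + 2 * a + real e + l * ?d) / (1 + a + l * ?d)) * aomoto_moment l a e I J"
      using pos by (simp add: field_simps del: of_real_add of_real_mult)
    moreover have "J \<subseteq> I" using insert.prems by auto
    ultimately show ?case
      using insert.IH insert.hyps by (simp del: of_real_add of_real_mult of_real_divide of_real_prod add: of_real_mult[symmetric] mult_ac)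
  qed simp
qed

text \<open>Morris's integral \<open>\<integral> \<Prod>j. (1 - z j) powr a (1 - cnj (z j)) powr b \<Prod>i<j. \<bar>z i - z j\<bar> powr (2 l)\<close> for \<open>a = b\<close>, over normalized
angles.\<close>

definition morris :: "real \<Rightarrow> 'i set \<Rightarrow> real \<Rightarrow> real" where
  "morris l I a = (\<integral>\<theta>. vandermonde l I \<theta> * (\<Prod>j\<in>I. cmod (1 - cis (\<theta> j)) powr (2 * a)) \<partial>angles I)"

definition morris_step :: "real \<Rightarrow> nat \<Rightarrow> real \<Rightarrow> real" where
  "morris_step l m a = (\<Prod>j<m. (1 + 2 * a + l * real j) * (2 + 2 * a + l * real j) / (1 + a + l * real j)\<^sup>2)"

text \<open>The moment with \<open>e = 0\<close> and \<open>J = I\<close> is a real multiple of \<open>morris l I a\<close>, hence equal to its conjugate, which is the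
moment with \<open>e = 1\<close> and \<open>J = {}\<close>. The recursion with \<open>e = 1\<close> then supplies the second factor of \<open>\<bar>1 - z\<bar>\<^sup>2\<close>.\<close>

lemma morris_plus_1:
  assumes fin: "finite I" and l: "l \<ge> 1 / 2" and a: "a \<ge> 0"
  shows "morris l I (a + 1) = morris_step l (card I) a * morris l I a"
proof -
  define m where "m = card I"
  define R where "R e = (\<Prod>r<m. (1 + 2 * a + real e + l * real r) / (1 + a + l * real r))" for e :: nat
  have full: "aomoto_moment l a e I I = of_real (R e) * aomoto_moment l a e I {}" for e
  proof -
    have "(\<Prod>r<m. (1 + 2 * a + real e + l * real (m - Suc r)) / (1 + a + l * real (m - Suc r))) = R e"
      unfolding R_def by (rule prod.nat_diff_reindex)
    then show ?thesis using aomoto_moment_eq[OF fin order_refl l a, of e] by (simp add: m_def)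
  qed
  have u2: "(1 - cis t) * (1 - cis (- t)) = of_real ((cmod (1 - cis t))\<^sup>2)" for t
    using complex_norm_square[of "1 - cis t"] by (simp add: cis_cnj)
  have T0: "aomoto_moment l a 0 I {} = of_real (morris l I a)"
    unfolding aomoto_moment_def morris_def integral_complex_of_real[symmetric]
    by (simp add: morris_weight_def one_body_weight_def)
  have "aomoto_moment l a 1 I {} = (\<integral>\<theta>. cnj (morris_weight l a 0 I \<theta> * (\<Prod>j\<in>I. 1 - cis (\<theta> j))) \<partial>angles I)"
    unfolding aomoto_moment_def
    by (rule Bochner_Integration.integral_cong)
       (simp_all add: morris_weight_def one_body_weight_def cis_cnj prod.distrib mult_ac)
  also have "\<dots> = cnj (aomoto_moment l a 0 I I)"
    unfolding aomoto_moment_def by (rule Bochner_Integration.integral_cnj)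
  finally have T1: "aomoto_moment l a 1 I {} = of_real (R 0 * morris l I a)"
    unfolding full T0 by simp
  have w: "cmod (1 - cis t) powr (2 * a) * (cmod (1 - cis t))\<^sup>2 = cmod (1 - cis t) powr (2 * (a + 1))" for t
    using a powr_add[of "cmod (1 - cis t)" "2 * a" 2] by (simp add: distrib_left)
  have "aomoto_moment l a 1 I I = of_real (morris l I (a + 1))"
  proof -
    have "morris_weight l a 1 I \<theta> * (\<Prod>j\<in>I. 1 - cis (\<theta> j))
        = of_real (vandermonde l I \<theta> * (\<Prod>j\<in>I. cmod (1 - cis (\<theta> j)) powr (2 * (a + 1))))" for \<theta>
    proof -
      have "(\<Prod>j\<in>I. one_body_weight a 1 (\<theta> j)) * (\<Prod>j\<in>I. 1 - cis (\<theta> j))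
          = (\<Prod>j\<in>I. of_real (cmod (1 - cis (\<theta> j)) powr (2 * a)) * ((1 - cis (\<theta> j)) * (1 - cis (- \<theta> j))))"
        unfolding prod.distrib[symmetric] one_body_weight_def by (intro prod.cong) (auto simp: mult_ac)
      also have "\<dots> = of_real (\<Prod>j\<in>I. cmod (1 - cis (\<theta> j)) powr (2 * (a + 1)))"
        unfolding u2 of_real_mult[symmetric] w of_real_prod ..
      finally show ?thesis by (simp add: morris_weight_def mult.assoc)
    qed
    then show ?thesis
      unfolding aomoto_moment_def morris_def by (simp only: integral_complex_of_real)
  qed
  with full[of 1] T1 have "complex_of_real (morris l I (a + 1)) = of_real (R 1 * (R 0 * morris l I a))"
    by simp
  then have "morris l I (a + 1) = R 1 * R 0 * morris l I a"
    by (simp only: of_real_eq_iff mult.assoc)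
  also have "R 1 * R 0 = morris_step l m a"
    unfolding R_def morris_step_def prod.distrib[symmetric] power2_eq_square
    by (intro prod.cong) (auto simp: add_ac mult_ac)
  finally show ?thesis by (simp add: m_def)
qed

subsection \<open>Log-convexity\<close>

lemma morris_weight_real_bounded:
  assumes "l \<ge> 0" "a \<ge> 0"
  obtains B where "B \<ge> 0" "\<And>\<theta>. \<bar>vandermonde l I \<theta> * (\<Prod>j\<in>I. cmod (1 - cis (\<theta> j)) powr (2 * a))\<bar> \<le> B"
proof -
  obtain B where B: "B \<ge> 0" "\<And>\<theta>. cmod (morris_weight l a 0 I \<theta>) \<le> B"
    using morris_weight_bounded[OF assms] by metis
  have eq: "morris_weight l a 0 I \<theta> = of_real (vandermonde l I \<theta> * (\<Prod>j\<in>I. cmod (1 - cis (\<theta> j)) powr (2 * a)))" for \<theta>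
    by (simp add: morris_weight_def one_body_weight_def)
  show ?thesis
    using B unfolding eq norm_of_real by (intro that) auto
qed

lemma morris_integrand_measurable [measurable]:
  "(\<lambda>\<theta>. vandermonde l I \<theta> * (\<Prod>j\<in>I. cmod (1 - cis (\<theta> j)) powr b)) \<in> borel_measurable (angles I)"
  by (intro borel_measurable_times vandermonde_measurable borel_measurable_prod powr_real_measurable
      borel_measurable_const cmod_measurable borel_measurable_diff cis_measurable angle_coordinate_measurable)

lemma integrable_morris:
  assumes "l \<ge> 0" "a \<ge> 0"
  shows "integrable (angles I) (\<lambda>\<theta>. vandermonde l I \<theta> * (\<Prod>j\<in>I. cmod (1 - cis (\<theta> j)) powr (2 * a)))"
proof -
  obtain B where B: "\<And>\<theta>. \<bar>vandermonde l I \<theta> * (\<Prod>j\<in>I. cmod (1 - cis (\<theta> j)) powr (2 * a))\<bar> \<le> B"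
    using morris_weight_real_bounded[OF assms, of I] by blast
  then show ?thesis
    by (intro integrable_angles[where B = B] morris_integrand_measurable) (simp only: real_norm_def)
qed

lemma morris_nonneg: "morris l I a \<ge> 0"
  unfolding morris_def by (intro integral_nonneg_AE AE_I2 mult_nonneg_nonneg vandermonde_nonneg prod_nonneg) auto

lemma morris_step_pos:
  assumes "l \<ge> 0" "a \<ge> 0"
  shows "morris_step l m a > 0"
  unfolding morris_step_def using assms
  by (intro prod_pos ballI divide_pos_pos mult_pos_pos zero_less_power)
     (auto intro!: add_pos_nonneg)

text \<open>The recursion gives positivity at the integers, and \<open>\<bar>1 - z\<bar> \<le> 2\<close> compares an arbitrary \<open>a\<close> with a larger integer.\<close>

lemma morris_pos:
  assumes fin: "finite I" and l: "l \<ge> 1 / 2" and a: "a \<ge> 0" and pos0: "morris l I 0 > 0"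
  shows "morris l I a > 0"
proof -
  have l0: "l \<ge> 0" using l by simp
  have nat_pos: "morris l I (real n) > 0" for n
  proof (induction n)
    case (Suc n)
    then show ?case
      using morris_plus_1[OF fin l, of "real n"] morris_step_pos[OF l0, of "real n" "card I"]
      by (simp add: add.commute)
  qed (use pos0 in simp)
  define n where "n = nat \<lceil>a\<rceil>"
  have n: "real n \<ge> a" unfolding n_def by linarith
  define C where "C = (\<Prod>j\<in>I. (2::real) powr (2 * (real n - a)))"
  have "morris l I (real n) \<le> C * morris l I a"
    unfolding morris_def integral_mult_right_zero[symmetric]
  proof (intro integral_mono integrable_mult_right integrable_morris l0 a)
    fix \<theta> :: "'a \<Rightarrow> real"
    have "(\<Prod>j\<in>I. cmod (1 - cis (\<theta> j)) powr (2 * real n)) \<le> (\<Prod>j\<in>I. 2 powr (2 * (real n - a)) * cmod (1 - cis (\<theta> j)) powr (2 * a))"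
    proof (intro prod_mono conjI)
      fix j
      have "cmod (1 - cis (\<theta> j)) powr (2 * real n) = cmod (1 - cis (\<theta> j)) powr (2 * (real n - a)) * cmod (1 - cis (\<theta> j)) powr (2 * a)"
        by (simp add: powr_add[symmetric] algebra_simps)
      also have "\<dots> \<le> 2 powr (2 * (real n - a)) * cmod (1 - cis (\<theta> j)) powr (2 * a)"
        using n by (intro mult_right_mono powr_mono2 cmod_one_minus_cis_le) auto
      finally show "cmod (1 - cis (\<theta> j)) powr (2 * real n) \<le> 2 powr (2 * (real n - a)) * cmod (1 - cis (\<theta> j)) powr (2 * a)" .
    qed auto
    also have "\<dots> = C * (\<Prod>j\<in>I. cmod (1 - cis (\<theta> j)) powr (2 * a))"
      by (simp add: C_def prod.distrib)
    finally show "vandermonde l I \<theta> * (\<Prod>j\<in>I. cmod (1 - cis (\<theta> j)) powr (2 * real n))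
        \<le> C * (vandermonde l I \<theta> * (\<Prod>j\<in>I. cmod (1 - cis (\<theta> j)) powr (2 * a)))"
      using mult_left_mono[OF _ vandermonde_nonneg[of l I \<theta>]] by (simp only: mult.left_commute[of C])
  qed auto
  with nat_pos[of n] show ?thesis
    using morris_nonneg[of l I a] by (cases "morris l I a = 0") auto
qed

lemma weighted_am_gm:
  fixes x y t :: real
  assumes "x \<ge> 0" "y \<ge> 0" "0 < t" "t < 1"
  shows "x powr (1 - t) * y powr t \<le> (1 - t) * x + t * y"
proof (cases "x = 0 \<or> y = 0")
  case False
  then have "x > 0" "y > 0" using assms by auto
  then have "x powr (1 - t) * y powr t = exp ((1 - t) *\<^sub>R ln x + t *\<^sub>R ln y)"
    by (simp add: powr_def exp_add)
  also have "\<dots> \<le> (1 - t) * exp (ln x) + t * exp (ln y)"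
    using assms by (intro convex_onD[OF exp_convex]) auto
  finally show ?thesis using \<open>x > 0\<close> \<open>y > 0\<close> by simp
qed (use assms in auto)

text \<open>This is the inequality of Hoelder: after dividing both integrands by their integrals, the weighted inequality of
arithmetic and geometric means holds pointwise, and it integrates to \<open>1\<close>.\<close>

lemma convex_on_ln_morris:
  assumes l: "l \<ge> 0" and pos: "\<And>a. a \<ge> 0 \<Longrightarrow> morris l I a > 0"
  shows "convex_on {0..} (\<lambda>a. ln (morris l I a))"
proof (rule convex_onI)
  fix t x y :: real
  assume t: "0 < t" "t < 1" and xy: "x \<in> {0..}" "y \<in> {0..}"
  define w where "w = (\<lambda>(\<theta> :: 'a \<Rightarrow> real) b. (\<Prod>j\<in>I. cmod (1 - cis (\<theta> j)) powr (2 * b)))"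
  define z where "z = (1 - t) * x + t * y"
  have z: "z \<ge> 0" using t xy by (auto simp: z_def)
  have px: "morris l I x > 0" and py: "morris l I y > 0" using pos xy by auto
  define c where "c = morris l I x powr (1 - t) * morris l I y powr t"
  have c: "c > 0" using px py by (simp add: c_def)
  have wint: "integrable (angles I) (\<lambda>\<theta>. vandermonde l I \<theta> * w \<theta> b)" if "b \<ge> 0" for b
    unfolding w_def using that l by (intro integrable_morris)
  have "vandermonde l I \<theta> * w \<theta> z / c \<le> (1 - t) * (vandermonde l I \<theta> * w \<theta> x / morris l I x) + t * (vandermonde l I \<theta> * w \<theta> y / morris l I y)" for \<theta>
  proof -
    have wn: "w \<theta> b \<ge> 0" for b by (auto simp: w_def intro!: prod_nonneg)
    have "w \<theta> z = (\<Prod>j\<in>I. cmod (1 - cis (\<theta> j)) powr (2 * ((1 - t) * x)) * cmod (1 - cis (\<theta> j)) powr (2 * (t * y)))"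
      unfolding w_def z_def by (simp add: powr_add[symmetric] distrib_left)
    also have "\<dots> = w \<theta> ((1 - t) * x) * w \<theta> (t * y)"
      by (simp add: w_def prod.distrib)
    also have "w \<theta> ((1 - t) * x) = w \<theta> x powr (1 - t)"
      unfolding w_def prod_powr_distrib powr_powr by (simp add: mult_ac)
    also have "w \<theta> (t * y) = w \<theta> y powr t"
      unfolding w_def prod_powr_distrib powr_powr by (simp add: mult_ac)
    finally have "w \<theta> z / c = (w \<theta> x / morris l I x) powr (1 - t) * (w \<theta> y / morris l I y) powr t"
      using wn px py by (simp add: c_def powr_divide)
    also have "\<dots> \<le> (1 - t) * (w \<theta> x / morris l I x) + t * (w \<theta> y / morris l I y)"
      using wn px py t by (intro weighted_am_gm) auto
    finally have "vandermonde l I \<theta> * (w \<theta> z / c) \<le> vandermonde l I \<theta> * ((1 - t) * (w \<theta> x / morris l I x) + t * (w \<theta> y / morris l I y))"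
      by (intro mult_left_mono vandermonde_nonneg)
    then show ?thesis by (simp add: algebra_simps)
  qed
  then have "(\<integral>\<theta>. vandermonde l I \<theta> * w \<theta> z / c \<partial>angles I)
     \<le> (\<integral>\<theta>. (1 - t) * (vandermonde l I \<theta> * w \<theta> x / morris l I x) + t * (vandermonde l I \<theta> * w \<theta> y / morris l I y) \<partial>angles I)"
    using xy z by (intro integral_mono Bochner_Integration.integrable_add integrable_mult_right integrable_divide wint) auto
  also have "\<dots> = (1 - t) * (morris l I x / morris l I x) + t * (morris l I y / morris l I y)"
    using wint xy by (simp add: morris_def w_def)
  also have "\<dots> = 1" using px py by simp
  finally have "morris l I z \<le> c"
    using c by (simp add: morris_def w_def field_simps)
  then have "ln (morris l I z) \<le> ln c"
    using pos[OF z] c by simp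
  also have "ln c = (1 - t) * ln (morris l I x) + t * ln (morris l I y)"
    using px py by (simp add: c_def ln_mult ln_powr)
  finally show "ln (morris l I ((1 - t) *\<^sub>R x + t *\<^sub>R y)) \<le> (1 - t) * ln (morris l I x) + t * ln (morris l I y)"
    by (simp add: z_def)
qed simp

section \<open>Log-convex functions and ratios of Gamma values\<close>

lemma convex_increment_le:
  fixes g :: "real \<Rightarrow> real"
  assumes "convex_on A g" "x \<in> A" "x + s + 1 \<in> A" "s \<ge> 0"
  shows "g (x + s) - g x \<le> s * (g (x + s + 1) - g (x + s))"
proof -
  define t where "t = s / (s + 1)"
  have t: "t * (s + 1) = s" "0 \<le> t" "t \<le> 1" using assms(4) by (auto simp: t_def)
  have "(1 - t) * x + t * (x + s + 1) = x + t * (s + 1)" by (simp add: algebra_simps)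
  then have eq: "(1 - t) *\<^sub>R x + t *\<^sub>R (x + s + 1) = x + s" by (simp add: t(1))
  have "g (x + s) \<le> (1 - t) * g x + t * g (x + s + 1)"
    using convex_onD[OF assms(1) t(2,3) assms(2,3)] unfolding eq .
  then have "(s + 1) * g (x + s) \<le> (s + 1) * ((1 - t) * g x + t * g (x + s + 1))"
    using assms(4) by (intro mult_left_mono) auto
  also have "\<dots> = (s + 1 - t * (s + 1)) * g x + t * (s + 1) * g (x + s + 1)"
    by (simp add: algebra_simps)
  also have "\<dots> = g x + s * g (x + s + 1)"
    unfolding t(1) by simp
  finally show ?thesis by (simp add: algebra_simps)
qed

lemma convex_increment_ge:
  fixes g :: "real \<Rightarrow> real"
  assumes "convex_on A g" "x - 1 \<in> A" "x + s \<in> A" "s \<ge> 0"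
  shows "s * (g x - g (x - 1)) \<le> g (x + s) - g x"
proof -
  define t where "t = 1 / (s + 1)"
  have t: "t * (s + 1) = 1" "0 \<le> t" "t \<le> 1" using assms(4) by (auto simp: t_def)
  have "(1 - t) * (x - 1) + t * (x + s) = x - 1 + t * (s + 1)" by (simp add: algebra_simps)
  then have eq: "(1 - t) *\<^sub>R (x - 1) + t *\<^sub>R (x + s) = x" by (simp add: t(1))
  have "g x \<le> (1 - t) * g (x - 1) + t * g (x + s)"
    using convex_onD[OF assms(1) t(2,3) assms(2,3)] unfolding eq .
  then have "(s + 1) * g x \<le> (s + 1) * ((1 - t) * g (x - 1) + t * g (x + s))"
    using assms(4) by (intro mult_left_mono) auto
  also have "\<dots> = (s + 1 - t * (s + 1)) * g (x - 1) + t * (s + 1) * g (x + s)"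
    by (simp add: algebra_simps)
  also have "\<dots> = s * g (x - 1) + g (x + s)"
    unfolding t(1) by simp
  finally show ?thesis by (simp add: algebra_simps)
qed

text \<open>The slope of \<open>ln f\<close> on \<open>[x, x + s]\<close> lies between its slopes on the adjacent unit intervals, and on those the recursion for
\<open>f (x + 1) / f x\<close> is available.\<close>

lemma log_convex_ratio_bounds:
  fixes f :: "real \<Rightarrow> real"
  assumes conv: "convex_on A (\<lambda>x. ln (f x))" and pos: "\<And>x. x \<in> A \<Longrightarrow> f x > 0" and s: "s \<ge> 0"
  shows "x \<in> A \<Longrightarrow> x + s \<in> A \<Longrightarrow> x + s + 1 \<in> A \<Longrightarrow> f (x + s) / f x \<le> (f (x + s + 1) / f (x + s)) powr s"
    and "x - 1 \<in> A \<Longrightarrow> x \<in> A \<Longrightarrow> x + s \<in> A \<Longrightarrow> (f x / f (x - 1)) powr s \<le> f (x + s) / f x"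
proof -
  assume A: "x \<in> A" "x + s \<in> A" "x + s + 1 \<in> A"
  note p = pos[OF A(1)] pos[OF A(2)] pos[OF A(3)]
  have "f (x + s) / f x = exp (ln (f (x + s)) - ln (f x))"
    using p by (simp add: exp_diff)
  also have "\<dots> \<le> exp (s * (ln (f (x + s + 1)) - ln (f (x + s))))"
    using convex_increment_le[OF conv A(1,3) s] by simp
  also have "\<dots> = (f (x + s + 1) / f (x + s)) powr s"
    using p by (simp add: powr_def ln_div)
  finally show "f (x + s) / f x \<le> (f (x + s + 1) / f (x + s)) powr s" .
next
  assume A: "x - 1 \<in> A" "x \<in> A" "x + s \<in> A"
  note p = pos[OF A(1)] pos[OF A(2)] pos[OF A(3)]
  have "(f x / f (x - 1)) powr s = exp (s * (ln (f x) - ln (f (x - 1))))"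
    using p by (simp add: powr_def ln_div)
  also have "\<dots> \<le> exp (ln (f (x + s)) - ln (f x))"
    using convex_increment_ge[OF conv A(1,3) s] by simp
  also have "\<dots> = f (x + s) / f x"
    using p by (simp add: exp_diff)
  finally show "(f x / f (x - 1)) powr s \<le> f (x + s) / f x" .
qed

lemma log_convex_ratio_limit:
  fixes f :: "real \<Rightarrow> real"
  assumes conv: "convex_on {0..} (\<lambda>x. ln (f x))" and pos: "\<And>x. x \<ge> 0 \<Longrightarrow> f x > 0" and s: "s \<ge> 0"
    and lim: "((\<lambda>x. f (x + 1) / f x) \<longlongrightarrow> L) at_top" and L: "L > 0"
  shows "((\<lambda>x. f (x + s) / f x) \<longlongrightarrow> L powr s) at_top"
proof (rule tendsto_sandwich)
  show "eventually (\<lambda>x. (f x / f (x - 1)) powr s \<le> f (x + s) / f x) at_top"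
    using eventually_ge_at_top[of 1]
    by eventually_elim (use s pos in \<open>auto intro!: log_convex_ratio_bounds(2)[OF conv]\<close>)
  show "eventually (\<lambda>x. f (x + s) / f x \<le> (f (x + s + 1) / f (x + s)) powr s) at_top"
    using eventually_ge_at_top[of 1]
    by eventually_elim (use s pos in \<open>auto intro!: log_convex_ratio_bounds(1)[OF conv]\<close>)
  have l1: "filterlim (\<lambda>x::real. x + s) at_top at_top" and l2: "filterlim (\<lambda>x::real. x - 1) at_top at_top"
    by (real_asymp | (subst filterlim_at_top_add_at_top, auto))+
  show "((\<lambda>x. (f (x + s + 1) / f (x + s)) powr s) \<longlongrightarrow> L powr s) at_top"
    using L by (intro tendsto_powr filterlim_compose[OF lim l1] tendsto_const) auto
  have "((\<lambda>x. f (x - 1 + 1) / f (x - 1)) \<longlongrightarrow> L) at_top"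
    by (rule filterlim_compose[OF lim l2])
  then show "((\<lambda>x. (f x / f (x - 1)) powr s) \<longlongrightarrow> L powr s) at_top"
    using L by (intro tendsto_powr tendsto_const) auto
qed

text \<open>The quotient \<open>f / h\<close> has period 1, so the limits along \<open>x = n\<close> compare its values at \<open>s\<close> and \<open>0\<close> exactly.\<close>

lemma same_recursion_imp_proportional:
  fixes f h :: "real \<Rightarrow> real"
  assumes pos: "\<And>x. x \<ge> 0 \<Longrightarrow> f x > 0" "\<And>x. x \<ge> 0 \<Longrightarrow> h x > 0"
    and rec: "\<And>x. x \<ge> 0 \<Longrightarrow> f (x + 1) = R x * f x" "\<And>x. x \<ge> 0 \<Longrightarrow> h (x + 1) = R x * h x"
    and lim: "((\<lambda>x. f (x + s) / f x) \<longlongrightarrow> c) at_top" "((\<lambda>x. h (x + s) / h x) \<longlongrightarrow> c) at_top"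
    and c: "c \<noteq> 0" and s: "s \<ge> 0"
  shows "f s / h s = f 0 / h 0"
proof -
  define G where "G x = f x / h x" for x
  have per1: "G (x + 1) = G x" if "x \<ge> 0" for x
  proof -
    have "R x \<noteq> 0" using rec(1)[OF that] pos(1)[of "x + 1"] that by auto
    then show ?thesis using rec[OF that] by (simp add: G_def)
  qed
  have per: "G (x + real n) = G x" if "x \<ge> 0" for x n
  proof (induction n)
    case (Suc n)
    then show ?case using per1[of "x + real n"] that by (simp add: add_ac)
  qed simp
  have "((\<lambda>x. (f (x + s) / f x) / (h (x + s) / h x)) \<longlongrightarrow> c / c) at_top"
    using lim c by (intro tendsto_divide)
  then have "(\<lambda>n. (f (real n + s) / f (real n)) / (h (real n + s) / h (real n))) \<longlonglongrightarrow> 1"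
    using c filterlim_compose[OF _ filterlim_real_sequentially] by force
  moreover have "(f (real n + s) / f (real n)) / (h (real n + s) / h (real n)) = G s / G 0" for n
  proof -
    have "(f (real n + s) / f (real n)) / (h (real n + s) / h (real n)) = G (s + real n) / G (0 + real n)"
      by (simp add: G_def add_ac)
    also have "\<dots> = G s / G 0" using s by (simp only: per order_refl)
    finally show ?thesis .
  qed
  ultimately have "G s / G 0 = 1"
    by (simp add: LIMSEQ_const_iff)
  then have "G s = G 0" by (simp only: divide_eq_1_iff)
  then show ?thesis by (simp only: G_def)
qed

lemma convex_on_ln_Gamma: "convex_on {0<..} (\<lambda>x. ln (Gamma x :: real))"
  using log_convex_Gamma_real by (simp add: o_def)

lemma Gamma_plus_1_real: "x > 0 \<Longrightarrow> Gamma (x + 1) = x * (Gamma x :: real)"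
  by (rule Gamma_plus1) (auto elim!: nonpos_Ints_cases)

lemma Gamma_ratio_upper:
  fixes x s :: real
  assumes "x > 0" "s \<ge> 0"
  shows "Gamma (x + s) / Gamma x \<le> (x + s) powr s"
proof -
  have "Gamma (x + s) / Gamma x \<le> (Gamma (x + s + 1) / Gamma (x + s)) powr s"
    using assms by (intro log_convex_ratio_bounds(1)[OF convex_on_ln_Gamma]) auto
  also have "Gamma (x + s + 1) / Gamma (x + s) = x + s"
    using assms Gamma_plus_1_real[of "x + s"] less_imp_neq[OF Gamma_real_pos[of "x + s"]] by simp
  finally show ?thesis .
qed

lemma Gamma_ratio_lower:
  fixes x s :: real
  assumes "x > 1" "s \<ge> 0"
  shows "(x - 1) powr s \<le> Gamma (x + s) / Gamma x"
proof -
  have "Gamma x / Gamma (x - 1) = x - 1"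
    using assms Gamma_plus_1_real[of "x - 1"] less_imp_neq[OF Gamma_real_pos[of "x - 1"]] by simp
  then have "(x - 1) powr s = (Gamma x / Gamma (x - 1)) powr s" by simp
  also have "\<dots> \<le> Gamma (x + s) / Gamma x"
    using assms by (intro log_convex_ratio_bounds(2)[OF convex_on_ln_Gamma]) auto
  finally show ?thesis .
qed

lemma Gamma_ratio_asymp:
  fixes s :: real
  assumes s: "s \<ge> 0"
  shows "((\<lambda>x. Gamma (x + s) / (Gamma x * x powr s)) \<longlongrightarrow> 1) at_top"
proof (rule tendsto_sandwich)
  show "eventually (\<lambda>x. ((x - 1) / x) powr s \<le> Gamma (x + s) / (Gamma x * x powr s)) at_top"
    using eventually_gt_at_top[of 1]
  proof eventually_elim
    case (elim x)
    then show ?case using divide_right_mono[OF Gamma_ratio_lower[OF elim s], of "x powr s"]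
      by (simp add: powr_divide)
  qed
  show "eventually (\<lambda>x. Gamma (x + s) / (Gamma x * x powr s) \<le> ((x + s) / x) powr s) at_top"
    using eventually_gt_at_top[of 0]
  proof eventually_elim
    case (elim x)
    then show ?case using divide_right_mono[OF Gamma_ratio_upper[OF elim s], of "x powr s"] s
      by (simp add: powr_divide)
  qed
  have "((\<lambda>x. (x - 1) / x) \<longlongrightarrow> (1::real)) at_top" "((\<lambda>x. (x + s) / x) \<longlongrightarrow> 1) at_top"
    by real_asymp+
  from tendsto_powr[OF this(1) tendsto_const, of s] tendsto_powr[OF this(2) tendsto_const, of s]
  show "((\<lambda>x. ((x - 1) / x) powr s) \<longlongrightarrow> 1) at_top" "((\<lambda>x. ((x + s) / x) powr s) \<longlongrightarrow> 1) at_top"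
    by auto
qed

text \<open>A convex function of \<open>x \<ge> 0\<close> that vanishes at \<open>0\<close> is superadditive; here it is \<open>ln (Gamma (x + 1))\<close>.\<close>

lemma Gamma_mult_le:
  fixes x y :: real
  assumes "x \<ge> 0" "y \<ge> 0"
  shows "Gamma (x + 1) * Gamma (y + 1) \<le> Gamma (x + y + 1)"
proof (cases "x + y = 0")
  case False
  then have xy: "x + y > 0" using assms by auto
  define t where "t = x / (x + y)"
  have t: "0 \<le> t" "t \<le> 1" using xy assms by (auto simp: t_def)
  let ?g = "\<lambda>x. ln (Gamma x :: real)"
  have "t * (x + y) = x" using xy by (simp add: t_def)
  then have e1: "(1 - t) *\<^sub>R 1 + t *\<^sub>R (x + y + 1) = x + 1"
    "(1 - (1 - t)) *\<^sub>R 1 + (1 - t) *\<^sub>R (x + y + 1) = y + 1"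
    by (auto simp: algebra_simps)
  have "?g ((1 - t) *\<^sub>R 1 + t *\<^sub>R (x + y + 1)) \<le> (1 - t) * ?g 1 + t * ?g (x + y + 1)"
    "?g ((1 - (1 - t)) *\<^sub>R 1 + (1 - t) *\<^sub>R (x + y + 1)) \<le> (1 - (1 - t)) * ?g 1 + (1 - t) * ?g (x + y + 1)"
    using xy t by (intro convex_onD[OF convex_on_ln_Gamma]; simp)+
  then have "?g (x + 1) + ?g (y + 1) \<le> t * ?g (x + y + 1) + (1 - t) * ?g (x + y + 1)"
    unfolding e1 by simp
  then have "?g (x + 1) + ?g (y + 1) \<le> ?g (x + y + 1)"
    by (simp add: algebra_simps)
  moreover have "ln (Gamma (x + 1) * Gamma (y + 1)) = ?g (x + 1) + ?g (y + 1)"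
    using assms by (intro ln_mult_pos) auto
  ultimately have "ln (Gamma (x + 1) * Gamma (y + 1)) \<le> ?g (x + y + 1)"
    by simp
  then show ?thesis
    using assms by (subst (asm) ln_le_cancel_iff) auto
next
  case True
  then have "x = 0" "y = 0" using assms by linarith+
  then show ?thesis by simp
qed

text \<open>\<open>Gamma\<close> is not monotone on \<open>[1, 2]\<close>, but it is at most 1 there and at least 1 from 2 on, because \<open>ln Gamma\<close> is convex and
vanishes at 1 and 2.\<close>

lemma Gamma_le_Gamma:
  fixes x y :: real
  assumes "1 \<le> x" "x \<le> y" "2 \<le> y"
  shows "Gamma x \<le> Gamma y"
proof -
  have g: "1 \<le> Gamma y"
  proof -
    have "(2 - 1) powr (y - 2) \<le> Gamma (2 + (y - 2)) / (Gamma 2 :: real)"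
      using assms by (intro Gamma_ratio_lower) auto
    moreover have "Gamma 2 = (1 :: real)" using Gamma_plus_1_real[of 1] by simp
    ultimately show ?thesis by simp
  qed
  define t where "t = (x - 1) / (y - 1)"
  have t: "0 \<le> t" "t \<le> 1" using assms by (auto simp: t_def)
  have "t * (y - 1) = x - 1" using assms by (simp add: t_def)
  then have e: "(1 - t) * 1 + t * y = x" by (simp add: algebra_simps)
  have "ln (Gamma ((1 - t) *\<^sub>R 1 + t *\<^sub>R y)) \<le> (1 - t) * ln (Gamma 1) + t * ln (Gamma y)"
    using t assms by (intro convex_onD[OF convex_on_ln_Gamma]) auto
  then have "ln (Gamma x) \<le> t * ln (Gamma y)" using e by simp
  also have "\<dots> \<le> 1 * ln (Gamma y)" using t g by (intro mult_right_mono) auto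
  finally show ?thesis using assms by (subst (asm) mult_1_left, subst (asm) ln_le_cancel_iff) auto
qed

section \<open>Evaluation of Morris's integral on the diagonal\<close>

text \<open>Morris's product formula for \<open>morris l I a\<close> with \<open>card I = m\<close>.\<close>

definition morris_gamma :: "real \<Rightarrow> nat \<Rightarrow> real \<Rightarrow> real" where
  "morris_gamma l m a = (\<Prod>j<m. Gamma (l * real j + 2 * a + 1) * Gamma (l * real (j + 1) + 1)
     / ((Gamma (l * real j + a + 1))\<^sup>2 * Gamma (1 + l)))"

lemma morris_gamma_pos:
  assumes "l \<ge> 0" "a \<ge> 0"
  shows "morris_gamma l m a > 0"
  unfolding morris_gamma_def using assms
  by (intro prod_pos ballI divide_pos_pos mult_pos_pos zero_less_power Gamma_real_pos) (auto intro!: add_nonneg_pos)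

lemma morris_gamma_plus_1:
  assumes l: "l \<ge> 0" and a: "a \<ge> 0"
  shows "morris_gamma l m (a + 1) = morris_step l m a * morris_gamma l m a"
proof -
  have "Gamma (l * real j + 2 * (a + 1) + 1) * Gamma (l * real (j + 1) + 1) / ((Gamma (l * real j + (a + 1) + 1))\<^sup>2 * Gamma (1 + l))
      = ((1 + 2 * a + l * real j) * (2 + 2 * a + l * real j) / (1 + a + l * real j)\<^sup>2)
        * (Gamma (l * real j + 2 * a + 1) * Gamma (l * real (j + 1) + 1) / ((Gamma (l * real j + a + 1))\<^sup>2 * Gamma (1 + l)))" for j
  proof -
    define x where "x = l * real j"
    have x: "x \<ge> 0" using l by (simp add: x_def)
    have "Gamma (x + 2 * (a + 1) + 1) = (x + 2 * a + 2) * Gamma (x + 2 * a + 2)"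
      using Gamma_plus_1_real[of "x + 2 * a + 2"] x a by (simp add: algebra_simps)
    also have "Gamma (x + 2 * a + 2) = (x + 2 * a + 1) * Gamma (x + 2 * a + 1)"
      using Gamma_plus_1_real[of "x + 2 * a + 1"] x a by (simp add: algebra_simps)
    finally have 1: "Gamma (x + 2 * (a + 1) + 1) = (2 + 2 * a + x) * (1 + 2 * a + x) * Gamma (x + 2 * a + 1)"
      by (simp add: algebra_simps)
    have 2: "Gamma (x + (a + 1) + 1) = (1 + a + x) * Gamma (x + a + 1)"
      using Gamma_plus_1_real[of "x + a + 1"] x a by (simp add: algebra_simps)
    show ?thesis unfolding x_def[symmetric] 1 2
      by (simp add: power_mult_distrib mult_ac)
  qed
  then show ?thesis
    unfolding morris_gamma_def morris_step_def prod.distrib[symmetric] by (intro prod.cong) auto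
qed

lemma morris_step_limit:
  assumes "l \<ge> 0"
  shows "(morris_step l m \<longlongrightarrow> 4 ^ m) at_top"
proof -
  have "((\<lambda>a. (1 + 2 * a + c) * (2 + 2 * a + c) / (1 + a + c)\<^sup>2) \<longlongrightarrow> 4) at_top" for c :: real
    by real_asymp
  then have "((\<lambda>a. \<Prod>j<m. (1 + 2 * a + l * real j) * (2 + 2 * a + l * real j) / (1 + a + l * real j)\<^sup>2) \<longlongrightarrow> (\<Prod>j<m. 4)) at_top"
    by (intro tendsto_prod)
  then show ?thesis by (simp add: morris_step_def[abs_def])
qed

lemma morris_gamma_ratio_limit:
  assumes l: "l \<ge> 0" and s: "s \<ge> 0"
  shows "((\<lambda>a. morris_gamma l m (a + s) / morris_gamma l m a) \<longlongrightarrow> (4 ^ m) powr s) at_top"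
proof -
  define G where "G t x = Gamma (x + t) / (Gamma x * x powr t)" for t x :: real
  have G: "(G t \<longlongrightarrow> 1) at_top" if "t \<ge> 0" for t
    unfolding G_def using Gamma_ratio_asymp[OF that] .
  have lim: "((\<lambda>a. G (2 * s) (c + 1 + 2 * a) / (G s (c + 1 + a))\<^sup>2 * ((c + 1 + 2 * a) / (c + 1 + a)) powr (2 * s)) \<longlongrightarrow> 1 / 1\<^sup>2 * 2 powr (2 * s)) at_top"
    for c :: real
  proof (intro tendsto_mult tendsto_divide tendsto_power tendsto_powr tendsto_const filterlim_compose[OF G])
    show "((\<lambda>a. (c + 1 + 2 * a) / (c + 1 + a)) \<longlongrightarrow> 2) at_top" by real_asymp
    show "filterlim (\<lambda>a. c + 1 + 2 * a) at_top at_top" "filterlim (\<lambda>a. c + 1 + a) at_top at_top" by real_asymp+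
  qed (use s in auto)
  have "((\<lambda>a. \<Prod>j<m. G (2 * s) (l * real j + 1 + 2 * a) / (G s (l * real j + 1 + a))\<^sup>2
       * ((l * real j + 1 + 2 * a) / (l * real j + 1 + a)) powr (2 * s)) \<longlongrightarrow> (\<Prod>j<m. 1 / 1\<^sup>2 * 2 powr (2 * s))) at_top"
    by (intro tendsto_prod lim)
  also have "(\<Prod>j<m. 1 / 1\<^sup>2 * (2::real) powr (2 * s)) = (4 ^ m) powr s"
  proof -
    have "(2::real) powr (2 * s) = 4 powr s" by (simp flip: powr_powr)
    then show ?thesis by (simp add: powr_realpow[symmetric] powr_powr mult.commute)
  qed
  finally have L: "((\<lambda>a. \<Prod>j<m. G (2 * s) (l * real j + 1 + 2 * a) / (G s (l * real j + 1 + a))\<^sup>2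
       * ((l * real j + 1 + 2 * a) / (l * real j + 1 + a)) powr (2 * s)) \<longlongrightarrow> (4 ^ m) powr s) at_top" .
  show ?thesis
  proof (rule Lim_transform_eventually[OF L])
    show "eventually (\<lambda>a. (\<Prod>j<m. G (2 * s) (l * real j + 1 + 2 * a) / (G s (l * real j + 1 + a))\<^sup>2
       * ((l * real j + 1 + 2 * a) / (l * real j + 1 + a)) powr (2 * s)) = morris_gamma l m (a + s) / morris_gamma l m a) at_top"
      using eventually_ge_at_top[of 0]
    proof eventually_elim
      case (elim a)
      have "G (2 * s) (c + 1 + 2 * a) / (G s (c + 1 + a))\<^sup>2 * ((c + 1 + 2 * a) / (c + 1 + a)) powr (2 * s)
         = (Gamma (c + 2 * (a + s) + 1) * d / ((Gamma (c + (a + s) + 1))\<^sup>2 * Gamma (1 + l)))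
           / (Gamma (c + 2 * a + 1) * d / ((Gamma (c + a + 1))\<^sup>2 * Gamma (1 + l)))" if "c \<ge> 0" "d > 0" for c d
      proof -
        define X where "X = c + 1 + 2 * a"
        define Y where "Y = c + 1 + a"
        have XY: "X > 0" "Y > 0" using that elim by (auto simp: X_def Y_def)
        have nz: "Gamma X \<noteq> 0" "Gamma Y \<noteq> 0" "Gamma (1 + l) \<noteq> 0" "Gamma (Y + s) \<noteq> 0" "X powr (2 * s) \<noteq> 0" "Y powr s \<noteq> 0" "d \<noteq> 0"
          using XY l s that(2) by (auto simp: less_imp_neq[OF Gamma_real_pos, symmetric])
        have pw: "Y powr (2 * s) = (Y powr s)\<^sup>2" by (simp add: powr_add[symmetric] power2_eq_square)
        have e: "c + 2 * (a + s) + 1 = X + 2 * s" "c + (a + s) + 1 = Y + s" "c + 2 * a + 1 = X" "c + a + 1 = Y"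
          by (auto simp: X_def Y_def)
        have "G (2 * s) X / (G s Y)\<^sup>2 * (X / Y) powr (2 * s)
            = (Gamma (X + 2 * s) * d / ((Gamma (Y + s))\<^sup>2 * Gamma (1 + l))) / (Gamma X * d / ((Gamma Y)\<^sup>2 * Gamma (1 + l)))"
          using nz XY unfolding G_def powr_divide pw by (simp add: field_simps power2_eq_square)
        then show ?thesis unfolding e X_def[symmetric] Y_def[symmetric] .
      qed
      note * = this[of "l * real j" "Gamma (l * real (j + 1) + 1)" for j]
      show ?case
        unfolding morris_gamma_def prod_dividef[symmetric] using l
        by (intro prod.cong refl *) (auto intro!: add_nonneg_pos Gamma_real_pos)
    qed
  qed
qed

lemma morris_gamma_0: "l \<ge> 0 \<Longrightarrow> morris_gamma l m 0 = Gamma (l * real m + 1) / Gamma (1 + l) ^ m"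
proof (induction m)
  case (Suc m)
  have "Gamma (l * real m + 1) > 0" using Suc.prems by (intro Gamma_real_pos add_nonneg_pos) auto
  then have "Gamma (l * real m + 1) \<noteq> 0" by simp
  moreover have "morris_gamma l (Suc m) 0 = morris_gamma l m 0 * (Gamma (l * real m + 1) * Gamma (l * real (Suc m) + 1) / ((Gamma (l * real m + 1))\<^sup>2 * Gamma (1 + l)))"
    by (simp add: morris_gamma_def)
  ultimately show ?case using Suc by (simp add: power2_eq_square)
qed (simp add: morris_gamma_def)

text \<open>Together with \<open>morris_gamma_0\<close> this says that the values for \<open>m + 1\<close> at \<open>0\<close> and for \<open>m\<close> at \<open>l\<close> coincide, as they do for the
integrals.\<close>

lemma morris_gamma_l: "l \<ge> 0 \<Longrightarrow> morris_gamma l m l = Gamma (l * real (Suc m) + 1) / Gamma (1 + l) ^ Suc m"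
proof (induction m)
  case 0
  have "Gamma (1 + l) > 0" using 0 by (intro Gamma_real_pos) auto
  then show ?case by (simp add: morris_gamma_def add.commute)
next
  case (Suc m)
  have "Gamma (l * real (Suc m) + 1) > 0" using Suc.prems by (intro Gamma_real_pos add_nonneg_pos) auto
  then have nz: "Gamma (l * real (Suc m) + 1) \<noteq> 0" by simp
  have e: "l * real m + 2 * l + 1 = l * real (Suc (Suc m)) + 1" "l * real m + l + 1 = l * real (Suc m) + 1" "m + 1 = Suc m"
    by (auto simp: algebra_simps)
  have "morris_gamma l (Suc m) l = morris_gamma l m l * (Gamma (l * real m + 2 * l + 1) * Gamma (l * real (m + 1) + 1) / ((Gamma (l * real m + l + 1))\<^sup>2 * Gamma (1 + l)))"
    by (simp add: morris_gamma_def)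
  also have "\<dots> = Gamma (l * real (Suc m) + 1) / Gamma (1 + l) ^ Suc m * (Gamma (l * real (Suc (Suc m)) + 1) * Gamma (l * real (Suc m) + 1) / ((Gamma (l * real (Suc m) + 1))\<^sup>2 * Gamma (1 + l)))"
    unfolding e Suc.IH[OF Suc.prems] ..
  also have "\<dots> = Gamma (l * real (Suc (Suc m)) + 1) / Gamma (1 + l) ^ Suc (Suc m)"
    using nz by (simp add: power2_eq_square del: of_nat_Suc)
  finally show ?case .
qed

lemma AE_cis_neq_1: "AE t in angle_measure. cis t \<noteq> 1"
proof -
  have "AE t in lborel. t \<notin> {t \<in> {-pi..pi}. cis t = 1}"
    by (intro AE_not_in finite_imp_null_set_lborel finite_cis_preimage)
  then show ?thesis
    unfolding angle_measure_def by (subst AE_density) (auto simp: indicator_def)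
qed

text \<open>Since \<open>0 powr 0 = 0\<close>, the integrand at \<open>a = 0\<close> differs from the interaction, but only where some particle is at \<open>1\<close>.\<close>

lemma morris_0:
  assumes "finite I"
  shows "morris l I 0 = (\<integral>\<theta>. vandermonde l I \<theta> \<partial>angles I)"
  unfolding morris_def
proof (rule integral_cong_AE)
  have "AE \<theta> in angles I. \<forall>i\<in>I. cis (\<theta> i) \<noteq> 1"
    using assms AE_cis_neq_1
    by (intro AE_finite_allI AE_PiM_component prob_space_angle_measure) auto
  then show "AE \<theta> in angles I. vandermonde l I \<theta> * (\<Prod>j\<in>I. cmod (1 - cis (\<theta> j)) powr (2 * 0)) = vandermonde l I \<theta>"
    by eventually_elim simp
qed (rule morris_integrand_measurable vandermonde_measurable)+

text \<open>For a fixed position of particle \<open>p\<close>, rotating all other particles moves \<open>p\<close> to angle 0; the inner integral therefore does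
not depend on that position.\<close>

lemma fix_one_angle:
  assumes fin: "finite I" and p: "p \<notin> I" and l: "l \<ge> 0" and a: "a \<ge> 0"
  shows "(\<integral>\<theta>. vandermonde l I \<theta> * (\<Prod>i\<in>I. cmod (cis (\<theta> p) - cis (\<theta> i)) powr (2 * a)) \<partial>angles (insert p I)) = morris l I a"
proof -
  define f where "f \<theta> = vandermonde l I \<theta> * (\<Prod>i\<in>I. cmod (cis (\<theta> p) - cis (\<theta> i)) powr (2 * a))" for \<theta>
  define F where "F z = (\<Prod>i\<in>I. \<Prod>j\<in>I - {i}. cmod (z i - z j) powr l) * (\<Prod>i\<in>I. cmod (1 - z i) powr (2 * a))" for z :: "'a \<Rightarrow> complex"
  have F: "F \<in> borel_measurable (PiM I (\<lambda>_. borel))"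
    unfolding F_def
    by (intro borel_measurable_times borel_measurable_prod powr_real_measurable borel_measurable_const
        cmod_measurable borel_measurable_diff measurable_component_singleton) auto
  have V: "(\<lambda>\<theta>. vandermonde l I \<theta>) \<in> borel_measurable (angles (insert p I))"
    unfolding vandermonde_def
    by (intro borel_measurable_prod powr_real_measurable borel_measurable_const cmod_measurable
      borel_measurable_diff cis_measurable angle_coordinate_measurable) auto
  have f: "f \<in> borel_measurable (angles (insert p I))"
    unfolding f_def
    by (intro borel_measurable_times V borel_measurable_prod powr_real_measurable borel_measurable_const cmod_measurable
      borel_measurable_diff cis_measurable angle_coordinate_measurable) auto
  obtain B where B: "B \<ge> 0" "\<And>\<theta>. vandermonde l I \<theta> \<le> B"
    using vandermonde_bounded[OF l, of I] by blast
  have fb: "norm (f \<theta>) \<le> B * (\<Prod>i\<in>I. 2 powr (2 * a))" for \<theta>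
  proof -
    have "(\<Prod>i\<in>I. cmod (cis (\<theta> p) - cis (\<theta> i)) powr (2 * a)) \<le> (\<Prod>i\<in>I. 2 powr (2 * a))"
      using a by (intro prod_mono conjI powr_mono2 cmod_cis_diff_le) auto
    then show ?thesis
      unfolding f_def norm_mult real_norm_def abs_of_nonneg[OF vandermonde_nonneg] using B
      by (subst abs_of_nonneg) (auto intro!: mult_mono mult_nonneg_nonneg prod_nonneg vandermonde_nonneg)
  qed
  have upd: "(\<lambda>(x, t). x(p := t)) \<in> measurable (angles I \<Otimes>\<^sub>M angle_measure) (angles (insert p I))"
    using measurable_add_dim[of p I "\<lambda>_. angle_measure"] by simp
  have inner: "(\<integral>x. f (x(p := t)) \<partial>angles I) = morris l I a" for t
  proof -
    have "f (x(p := t)) = F (\<lambda>i\<in>I. cis (- t + x i))" for x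
    proof -
      have d: "cmod (cis (u - t) - cis (v - t)) = cmod (cis u - cis v)" for u v
        unfolding cis_divide[symmetric] diff_divide_distrib[symmetric] norm_divide by simp
      have "cmod (cis t - cis u) = cmod (1 - cis (u - t))" for u
        using d[of t u] by simp
      moreover have "vandermonde l I (x(p := t)) = vandermonde l I x"
        using p by (intro vandermonde_cong) auto
      moreover have "(\<Prod>i\<in>I. cmod (cis t - cis ((x(p := t)) i)) powr (2 * a)) = (\<Prod>i\<in>I. cmod (cis t - cis (x i)) powr (2 * a))"
        using p by (intro prod.cong) auto
      ultimately show ?thesis
        by (simp add: f_def F_def vandermonde_def d)
    qed
    then have "(\<integral>x. f (x(p := t)) \<partial>angles I) = (\<integral>x. F (\<lambda>i\<in>I. cis (- t + x i)) \<partial>angles I)"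
      by simp
    also have "\<dots> = (\<integral>x. F (\<lambda>i\<in>I. cis (x i)) \<partial>angles I)"
      by (rule integral_angles_rotate[OF fin F])
    also have "\<dots> = morris l I a"
      by (simp add: F_def morris_def vandermonde_def)
    finally show ?thesis .
  qed
  interpret pair_prob_space "angles I" angle_measure
    by (intro pair_prob_space.intro pair_sigma_finite.intro prob_space_imp_sigma_finite prob_space_angles prob_space_angle_measure)
  have "integrable (angles I \<Otimes>\<^sub>M angle_measure) (\<lambda>(x, t). f (x(p := t)))"
  proof (rule finite_measure.integrable_const_bound[where B = "B * (\<Prod>i\<in>I. 2 powr (2 * a))"])
    show "finite_measure (angles I \<Otimes>\<^sub>M angle_measure)" by unfold_locales
    show "(\<lambda>(x, t). f (x(p := t))) \<in> borel_measurable (angles I \<Otimes>\<^sub>M angle_measure)"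
      using measurable_compose[OF upd f] unfolding case_prod_unfold .
    show "AE y in angles I \<Otimes>\<^sub>M angle_measure. norm (case y of (x, t) \<Rightarrow> f (x(p := t))) \<le> B * (\<Prod>i\<in>I. 2 powr (2 * a))"
      unfolding case_prod_unfold by (intro AE_I2 fb)
  qed
  from Fubini_integral[OF this] have "(\<integral>x. (\<integral>t. f (x(p := t)) \<partial>angle_measure) \<partial>angles I)
     = (\<integral>t. (\<integral>x. f (x(p := t)) \<partial>angles I) \<partial>angle_measure)" by simp
  moreover have "(\<integral>\<theta>. f \<theta> \<partial>angles (insert p I)) = (\<integral>x. (\<integral>t. f (x(p := t)) \<partial>angle_measure) \<partial>angles I)"
    by (rule integral_angles_insert[OF fin p f fb])
  ultimately have "(\<integral>\<theta>. f \<theta> \<partial>angles (insert p I)) = (\<integral>t. morris l I a \<partial>angle_measure)"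
    by (simp only: inner)
  also have "\<dots> = morris l I a"
    using angle.prob_space by simp
  finally show ?thesis by (simp only: f_def)
qed

text \<open>Induction on the number of particles. Adding the particle \<open>p\<close> and fixing it at angle 0 evaluates the new integral at
\<open>a = 0\<close>; log-convexity and the recursion carry this value to all \<open>a \<ge> 0\<close>.\<close>

theorem morris_eq_morris_gamma:
  assumes fin: "finite I" and l: "l \<ge> 1 / 2" and a: "a \<ge> 0"
  shows "morris l I a = morris_gamma l (card I) a"
  using fin a
proof (induction I arbitrary: a rule: finite_induct)
  case empty
  show ?case
    using prob_space.prob_space[OF prob_space_angles[of "{} :: 'a set"]]
    by (simp add: morris_def vandermonde_def morris_gamma_def)
next
  case (insert p I)
  have l0: "l \<ge> 0" using l by simp
  let ?J = "insert p I"
  let ?m = "card ?J"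
  have fin: "finite ?J" using insert by simp
  have m: "?m = Suc (card I)" using insert by simp
  have "morris l ?J 0 = morris l I l"
    unfolding morris_0[OF fin] vandermonde_insert[OF insert.hyps]
    by (rule fix_one_angle[OF insert.hyps l0 l0])
  also have "\<dots> = morris_gamma l (card I) l" by (rule insert.IH[OF l0])
  also have "\<dots> = morris_gamma l ?m 0"
    unfolding m morris_gamma_0[OF l0] morris_gamma_l[OF l0] ..
  finally have at0: "morris l ?J 0 = morris_gamma l ?m 0" .
  have pos0: "morris l ?J 0 > 0" unfolding at0 by (intro morris_gamma_pos l0) simp
  note pos = morris_pos[OF fin l _ pos0]
  have ratio: "((\<lambda>x. morris l ?J (x + 1) / morris l ?J x) \<longlongrightarrow> 4 ^ ?m) at_top"
  proof (rule Lim_transform_eventually[OF morris_step_limit[OF l0]])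
    show "eventually (\<lambda>x. morris_step l ?m x = morris l ?J (x + 1) / morris l ?J x) at_top"
      using eventually_ge_at_top[of 0]
    proof eventually_elim
      case (elim x)
      then show ?case using pos[OF elim] morris_plus_1[OF fin l elim] by simp
    qed
  qed
  have "morris l ?J a / morris_gamma l ?m a = morris l ?J 0 / morris_gamma l ?m 0"
  proof (rule same_recursion_imp_proportional)
    show "((\<lambda>x. morris l ?J (x + a) / morris l ?J x) \<longlongrightarrow> (4 ^ ?m) powr a) at_top"
      by (rule log_convex_ratio_limit[OF convex_on_ln_morris[OF l0 pos] pos insert.prems ratio]) auto
    show "((\<lambda>x. morris_gamma l ?m (x + a) / morris_gamma l ?m x) \<longlongrightarrow> (4 ^ ?m) powr a) at_top"
      by (rule morris_gamma_ratio_limit[OF l0 insert.prems])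
  qed (use pos morris_gamma_pos[OF l0] morris_plus_1[OF fin l] morris_gamma_plus_1[OF l0] insert.prems in auto)
  also have "\<dots> = 1" using pos0 at0 by simp
  finally show ?case by simp
qed

section \<open>The partition functions\<close>

lemma sets_angles: "sets (angles I) = sets (PiM I (\<lambda>_. lborel))"
  by (intro sets_PiM_cong) auto

lemma angles_eq_density:
  assumes fin: "finite I"
  shows "angles I = density (PiM I (\<lambda>_. lborel)) (\<lambda>\<theta>. \<Prod>j\<in>I. ennreal (indicator {-pi..pi} (\<theta> j) / (2 * pi)))"
    (is "_ = density ?L ?w")
proof (rule sym, rule angle_prod.PiM_eqI[OF fin])
  interpret L: product_sigma_finite "\<lambda>_ :: 'a. lborel :: real measure" by standard
  show "sets (density ?L ?w) = sets (angles I)" by (simp add: sets_angles)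
  fix A assume A: "\<And>i. i \<in> I \<Longrightarrow> A i \<in> sets angle_measure"
  have w: "?w \<in> borel_measurable ?L"
    by (intro borel_measurable_prod_ennreal measurable_compose[OF measurable_component_singleton]) auto
  have AI: "PiE I A \<in> sets ?L" using A fin by (intro sets_PiM_I_finite) auto
  have "emeasure (density ?L ?w) (PiE I A) = (\<integral>\<^sup>+\<theta>. ?w \<theta> * indicator (PiE I A) \<theta> \<partial>?L)"
    by (rule emeasure_density[OF w AI])
  also have "\<dots> = (\<integral>\<^sup>+\<theta>. (\<Prod>j\<in>I. ennreal (indicator {-pi..pi} (\<theta> j) / (2 * pi)) * indicator (A j) (\<theta> j)) \<partial>?L)"
  proof (rule nn_integral_cong)
    fix \<theta> assume "\<theta> \<in> space ?L"
    then have "\<theta> \<in> extensional I" by (simp add: space_PiM PiE_def)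
    then have "indicator (PiE I A) \<theta> = (\<Prod>j\<in>I. indicator (A j) (\<theta> j) :: ennreal)"
      using fin by (induction "\<theta> \<in> PiE I A") (auto simp: indicator_def PiE_def Pi_def)
    then show "?w \<theta> * indicator (PiE I A) \<theta> = (\<Prod>j\<in>I. ennreal (indicator {-pi..pi} (\<theta> j) / (2 * pi)) * indicator (A j) (\<theta> j))"
      by (simp add: prod.distrib)
  qed
  also have "\<dots> = (\<Prod>j\<in>I. \<integral>\<^sup>+t. ennreal (indicator {-pi..pi} t / (2 * pi)) * indicator (A j) t \<partial>lborel)"
    using A by (intro L.product_nn_integral_prod fin) auto
  also have "\<dots> = (\<Prod>j\<in>I. emeasure angle_measure (A j))"
    using A unfolding angle_measure_def by (intro prod.cong refl emeasure_density[symmetric]) auto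
  finally show "emeasure (density ?L ?w) (PiE I A) = (\<Prod>j\<in>I. emeasure angle_measure (A j))" .
qed

lemma set_integral_cube:
  fixes f :: "('i \<Rightarrow> real) \<Rightarrow> real"
  assumes fin: "finite I" and f: "f \<in> borel_measurable (angles I)"
  shows "(LINT \<theta> : (\<Pi>\<^sub>E j\<in>I. {-pi..pi}) | (\<Pi>\<^sub>M j\<in>I. lborel). f \<theta>) = (2 * pi) ^ card I * (\<integral>\<theta>. f \<theta> \<partial>angles I)"
proof -
  let ?L = "\<Pi>\<^sub>M j\<in>I. (lborel :: real measure)"
  have f': "f \<in> borel_measurable ?L" using f by (simp only: measurable_cong_sets[OF sets_angles refl])
  define w where "w \<theta> = (\<Prod>j\<in>I. indicator {-pi..pi} (\<theta> j) / (2 * pi))" for \<theta> :: "'i \<Rightarrow> real"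
  have w: "w \<in> borel_measurable ?L"
    unfolding w_def
    by (intro borel_measurable_prod borel_measurable_divide measurable_compose[OF measurable_component_singleton]) auto
  have wn: "w \<theta> \<ge> 0" for \<theta> by (auto simp: w_def intro!: prod_nonneg)
  have "angles I = density ?L (\<lambda>\<theta>. ennreal (w \<theta>))"
    unfolding angles_eq_density[OF fin] w_def by (subst prod_ennreal) auto
  then have "(\<integral>\<theta>. f \<theta> \<partial>angles I) = (\<integral>\<theta>. f \<theta> \<partial>density ?L (\<lambda>\<theta>. ennreal (w \<theta>)))"
    by (simp only:)
  also have "\<dots> = (\<integral>\<theta>. w \<theta> *\<^sub>R f \<theta> \<partial>?L)"
    by (rule integral_density[OF f' w AE_I2[OF wn]])
  also have "\<dots> = (\<integral>\<theta>. (1 / (2 * pi) ^ card I) * (indicator (\<Pi>\<^sub>E j\<in>I. {-pi..pi}) \<theta> *\<^sub>R f \<theta>) \<partial>?L)"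
  proof (rule Bochner_Integration.integral_cong[OF refl])
    fix \<theta> assume "\<theta> \<in> space ?L"
    then have ext: "\<theta> \<in> extensional I" by (simp add: space_PiM PiE_def)
    have "(\<Prod>j\<in>I. indicator {-pi..pi} (\<theta> j) :: real) = indicator (\<Pi>\<^sub>E j\<in>I. {-pi..pi}) \<theta>"
      using fin ext by (cases "\<theta> \<in> (\<Pi>\<^sub>E j\<in>I. {-pi..pi})") (auto simp: indicator_def PiE_def Pi_def)
    then have "w \<theta> = (1 / (2 * pi) ^ card I) * indicator (\<Pi>\<^sub>E j\<in>I. {-pi..pi}) \<theta>"
      by (simp add: w_def prod_dividef)
    then show "w \<theta> *\<^sub>R f \<theta> = (1 / (2 * pi) ^ card I) * (indicator (\<Pi>\<^sub>E j\<in>I. {-pi..pi}) \<theta> *\<^sub>R f \<theta>)"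
      by simp
  qed
  also have "\<dots> = (1 / (2 * pi) ^ card I) * (LINT \<theta> : (\<Pi>\<^sub>E j\<in>I. {-pi..pi}) | ?L. f \<theta>)"
    unfolding set_lebesgue_integral_def by (rule integral_mult_right_zero)
  finally show ?thesis by simp
qed

lemma prod_pairs_Suc:
  fixes f :: "nat \<Rightarrow> nat \<Rightarrow> real"
  shows "(\<Prod>(j, l) \<in> {(j, l). 1 \<le> j \<and> j < l \<and> l \<le> Suc n}. f j l)
       = (\<Prod>(j, l) \<in> {(j, l). 1 \<le> j \<and> j < l \<and> l \<le> n}. f j l) * (\<Prod>j\<in>{1..n}. f j (Suc n))"
proof -
  have eq: "{(j, l). 1 \<le> j \<and> j < l \<and> l \<le> Suc n} = {(j, l). 1 \<le> j \<and> j < l \<and> l \<le> n} \<union> (\<lambda>j. (j, Suc n)) ` {1..n}"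
    by (auto simp: le_Suc_eq)
  have fin: "finite {(j, l). 1 \<le> j \<and> j < l \<and> l \<le> n}"
    by (rule finite_subset[of _ "{1..n} \<times> {1..n}"]) auto
  show ?thesis
    unfolding eq by (subst prod.union_disjoint[OF fin]) (auto simp: prod.reindex inj_on_def)
qed

lemma prod_pairs_eq_vandermonde:
  fixes \<theta> :: "nat \<Rightarrow> real"
  shows "(\<Prod>(j, l) \<in> {(j, l). 1 \<le> j \<and> j < l \<and> l \<le> n}. cmod (cis (\<theta> j) - cis (\<theta> l)) powr \<beta>)
   = vandermonde (\<beta> / 2) {1..n} \<theta>"
proof (induction n)
  case 0
  have e: "{(j, l). 1 \<le> j \<and> j < l \<and> l \<le> (0::nat)} = {}" by auto
  show ?case unfolding e by (simp add: vandermonde_def)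
next
  case (Suc n)
  have "{1..Suc n} = insert (Suc n) {1..n}" by auto
  then show ?case
    unfolding prod_pairs_Suc Suc by (simp add: vandermonde_insert norm_minus_commute)
qed

lemma C_charge_eq_morris_gamma:
  assumes \<beta>: "\<beta> \<ge> 1"
  shows "C_charge \<beta> m k = (2 * pi) ^ (m + 1) * morris_gamma (\<beta> / 2) m (real k * (\<beta> / 2))"
proof -
  have I: "{1..m + 1} = insert (Suc m) {1..m}" by auto
  let ?q = "\<lambda>j. if j \<le> m then 1 else k :: nat"
  define F where "F \<theta> = vandermonde (\<beta> / 2) {1..m} \<theta>
      * (\<Prod>i\<in>{1..m}. cmod (cis (\<theta> (Suc m)) - cis (\<theta> i)) powr (2 * (real k * (\<beta> / 2))))" for \<theta>
  have F: "(\<Prod>(j, l) \<in> {(j, l). 1 \<le> j \<and> j < l \<and> l \<le> m + 1}.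
           cmod (cis (\<theta> j) - cis (\<theta> l)) powr (real (?q j) * real (?q l) * \<beta>)) = F \<theta>" for \<theta>
  proof -
    have "(\<Prod>(j, l) \<in> {(j, l). 1 \<le> j \<and> j < l \<and> l \<le> m}. cmod (cis (\<theta> j) - cis (\<theta> l)) powr (real (?q j) * real (?q l) * \<beta>))
       = (\<Prod>(j, l) \<in> {(j, l). 1 \<le> j \<and> j < l \<and> l \<le> m}. cmod (cis (\<theta> j) - cis (\<theta> l)) powr \<beta>)"
      by (intro prod.cong) auto
    then show ?thesis
      unfolding Suc_eq_plus1[symmetric] prod_pairs_Suc prod_pairs_eq_vandermonde F_def
      by (simp add: norm_minus_commute)
  qed
  have meas: "F \<in> borel_measurable (angles {1..m + 1})"
    unfolding F_def vandermonde_def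
    by (intro borel_measurable_times borel_measurable_prod powr_real_measurable borel_measurable_const cmod_measurable
      borel_measurable_diff cis_measurable angle_coordinate_measurable) auto
  have "C_charge \<beta> m k = (2 * pi) ^ (m + 1) * (\<integral>\<theta>. F \<theta> \<partial>angles {1..m + 1})"
    unfolding C_charge_def partition_fun_def F set_integral_cube[OF finite_atLeastAtMost meas] by simp
  also have "(\<integral>\<theta>. F \<theta> \<partial>angles {1..m + 1}) = morris (\<beta> / 2) {1..m} (real k * (\<beta> / 2))"
    unfolding F_def I using \<beta> by (intro fix_one_angle) auto
  also have "\<dots> = morris_gamma (\<beta> / 2) m (real k * (\<beta> / 2))"
    using \<beta> by (subst morris_eq_morris_gamma) auto
  finally show ?thesis .
qed

lemma C_one_eq: "n \<ge> 1 \<Longrightarrow> C_one \<beta> n = C_charge \<beta> (n - 1) 1"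
  by (simp only: C_one_def C_charge_def if_cancel) simp

lemma C_two_eq: "C_two \<beta> n 1 = C_charge \<beta> n 2"
  by (simp add: C_two_def C_charge_def)

section \<open>The ratio of partition functions\<close>

text \<open>Increasing \<open>m\<close> by one changes only the first and the last factor of a product of \<open>k\<close> consecutive values.\<close>

lemma prod_shift_ratio:
  fixes g :: "nat \<Rightarrow> real"
  assumes "\<And>i. g i \<noteq> 0"
  shows "(\<Prod>i<k. g (Suc m + i)) = (\<Prod>i<k. g (m + i)) * g (m + k) / g m"
  using assms by (induction k) (auto simp: field_simps)

text \<open>For \<open>a = k l\<close> all arguments of \<open>Gamma\<close> are of the form \<open>l i + 1\<close>, and the product over \<open>m\<close> indices telescopes to products
of length \<open>k\<close>, which stays fixed as \<open>m\<close> grows.\<close>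

lemma morris_gamma_multiple:
  assumes l: "l \<ge> 0"
  defines "g \<equiv> \<lambda>i. Gamma (l * real i + 1)"
  shows "morris_gamma l m (real k * l) =
    (\<Prod>i<k. g (m + k + i)) * (\<Prod>i<k. g i) * g m / ((\<Prod>i<k. g (k + i)) * (\<Prod>i<k. g (m + i)) * g 1 ^ m)"
proof (induction m)
  have g: "g i \<noteq> 0" for i
  proof -
    have "g i > 0" unfolding g_def using l by (intro Gamma_real_pos add_nonneg_pos) auto
    then show ?thesis by simp
  qed
  {
    case 0
    have "g 0 = 1" by (simp add: g_def)
    then show ?case using g by (simp add: morris_gamma_def)
  next
    case (Suc m)
    have e: "l * real m + 2 * (real k * l) + 1 = l * real (m + k + k) + 1" "l * real m + real k * l + 1 = l * real (m + k) + 1"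
      "1 + l = l * real 1 + 1"
      by (auto simp: algebra_simps)
    have step: "morris_gamma l (Suc m) (real k * l) = morris_gamma l m (real k * l) * (g (m + k + k) * g (Suc m) / ((g (m + k))\<^sup>2 * g 1))"
      unfolding morris_gamma_def g_def e[symmetric] by simp
    have a: "(\<Prod>i<k. g (Suc m + k + i)) = (\<Prod>i<k. g (m + k + i)) * g (m + k + k) / g (m + k)"
      using prod_shift_ratio[where g = g and m = "m + k" and k = k] g by simp
    have b: "(\<Prod>i<k. g (Suc m + i)) = (\<Prod>i<k. g (m + i)) * g (m + k) / g m"
      using prod_shift_ratio[where g = g and m = m and k = k] g by simp
    have P: "(\<Prod>i<k. g (c + i)) \<noteq> 0" for c using g by simp
    show ?case
      unfolding step Suc a b using g P[of "m + k"] P[of m] P[of k] P[of 0]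
      by (simp add: field_simps power2_eq_square)
  }
qed

lemma prod_lessThan_split:
  fixes h :: "nat \<Rightarrow> real"
  assumes "k \<ge> 1"
  shows "(\<Prod>i<k. h i) = h 0 * (\<Prod>i=1..k - 1. h i)"
proof -
  have "{..<k} = insert 0 {1..k - 1}" using assms by auto
  then show ?thesis by simp
qed

text \<open>The part of \<open>A_charge\<close> that does not come from the asymptotics of \<open>Gamma\<close>.\<close>

definition charge_constant :: "real \<Rightarrow> nat \<Rightarrow> real" where
  "charge_constant l k = (2 * pi) powi (1 - int k) * Gamma (l + 1) ^ k / Gamma (real k * l + 1)
     * (\<Prod>j = 1..k - 1. Gamma (real j * l + 1) / Gamma (real (k + j) * l + 1))"

lemma A_charge_eq: "A_charge \<beta> k = charge_constant (\<beta> / 2) k * (\<beta> / 2) powr (real k * (real k - 1) * \<beta> / 2)"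
  by (simp add: A_charge_def charge_constant_def)

lemma C_charge_over_C_one:
  assumes \<beta>: "\<beta> \<ge> 1" and k: "k \<ge> 1" and n: "n \<ge> k"
  shows "C_charge \<beta> (n - k) k = C_one \<beta> n * (charge_constant (\<beta> / 2) k
     * (\<Prod>i = 1..k - 1. Gamma (\<beta> / 2 * (real n + real i) + 1) / Gamma (\<beta> / 2 * (real n - real i) + 1)))"
    and "C_one \<beta> n > 0"
proof -
  define l where "l = \<beta> / 2"
  have l: "l \<ge> 0" using \<beta> by (simp add: l_def)
  define g where "g i = Gamma (l * real i + 1)" for i
  have gp: "g i > 0" for i unfolding g_def using l by (intro Gamma_real_pos add_nonneg_pos) auto
  have g: "g i \<noteq> 0" for i using gp[of i] by simp
  have g0: "g 0 = 1" by (simp add: g_def)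
  define m where "m = n - k"
  have nm: "n = m + k" using n by (simp add: m_def)
  have one: "C_one \<beta> n = (2 * pi) ^ n * (g n / g 1 ^ n)"
  proof -
    have "C_one \<beta> n = (2 * pi) ^ (n - 1 + 1) * morris_gamma l (n - 1) l"
      using k n C_charge_eq_morris_gamma[OF \<beta>, of "n - 1" 1] by (simp add: C_one_eq l_def)
    then show ?thesis using morris_gamma_l[OF l, of "n - 1"] k n by (simp add: g_def add.commute)
  qed
  show "C_one \<beta> n > 0" unfolding one using gp by (intro mult_pos_pos divide_pos_pos zero_less_power) auto
  define A B C D where "A = (\<Prod>i=1..k - 1. g (n + i))" and "B = (\<Prod>i=1..k - 1. g i)"
    and "C = (\<Prod>i=1..k - 1. g (k + i))" and "D = (\<Prod>i=1..k - 1. g (n - i))"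
  have nz: "A \<noteq> 0" "B \<noteq> 0" "C \<noteq> 0" "D \<noteq> 0" using g by (auto simp: A_def B_def C_def D_def)
  have "(\<Prod>i=1..k - 1. g (m + i)) = D"
    unfolding D_def nm by (intro prod.reindex_bij_witness[of _ "\<lambda>i. k - i" "\<lambda>i. k - i"]) auto
  then have "morris_gamma l m (real k * l) = g n * A * B * g m / (g k * C * (g m * D) * g 1 ^ m)"
    unfolding morris_gamma_multiple[OF l] g_def[symmetric] prod_lessThan_split[OF k]
    by (simp add: nm g0 A_def B_def C_def)
  then have ch: "C_charge \<beta> m k = (2 * pi) ^ (m + 1) * (g n * A * B / (g k * C * D * g 1 ^ m))"
    using C_charge_eq_morris_gamma[OF \<beta>, of m k] g by (simp add: l_def[symmetric])
  have cc: "charge_constant l k = (2 * pi) powi (1 - int k) * g 1 ^ k / g k * (B / C)"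
    by (simp add: charge_constant_def g_def B_def C_def prod_dividef mult.commute)
  have AD: "(\<Prod>i = 1..k - 1. Gamma (\<beta> / 2 * (real n + real i) + 1) / Gamma (\<beta> / 2 * (real n - real i) + 1)) = A / D"
    unfolding A_def D_def prod_dividef[symmetric] g_def l_def
    using n by (intro prod.cong) (auto simp: of_nat_diff)
  have pw: "(2 * pi) ^ (m + 1) = (2 * pi) ^ n * (2 * pi) powi (1 - int k)"
  proof -
    have "(2 * pi) powi (int n + (1 - int k)) = (2 * pi) powi int n * (2 * pi) powi (1 - int k)"
      by (rule power_int_add) auto
    moreover have "int n + (1 - int k) = int (m + 1)" using nm by simp
    ultimately show ?thesis by (simp only: power_int_of_nat)
  qed
  have "C_charge \<beta> m k = C_one \<beta> n * (charge_constant l k * (A / D))"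
    unfolding ch one cc pw using g nz by (simp add: nm power_add field_simps)
  then show "C_charge \<beta> (n - k) k = C_one \<beta> n * (charge_constant (\<beta> / 2) k
     * (\<Prod>i = 1..k - 1. Gamma (\<beta> / 2 * (real n + real i) + 1) / Gamma (\<beta> / 2 * (real n - real i) + 1)))"
    unfolding AD by (simp add: m_def l_def)
qed

lemma sum_charge_exponents: "(\<Sum>i = 1..k - 1. 2 * real i * l) = real k * (real k - 1) * l"
proof (induction k)
  case (Suc k)
  then show ?case by (cases k) (auto simp: algebra_simps)
qed simp

lemma prod_charge_powr:
  assumes "x > 0"
  shows "(\<Prod>i = 1..k - 1. x powr (2 * real i * l)) = x powr (real k * (real k - 1) * l)"
proof -
  have "(\<Prod>i = 1..k - 1. x powr (2 * real i * l)) = x powr (\<Sum>i = 1..k - 1. 2 * real i * l)"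
    using assms by (subst powr_sum) auto
  then show ?thesis by (simp only: sum_charge_exponents)
qed

text \<open>By superadditivity of \<open>\<lambda>x. ln (Gamma (x + 1))\<close> the power \<open>Gamma (l + 1) ^ k\<close> is at most \<open>Gamma (k l + 1)\<close>. The other quotients
are at most 1 because \<open>(k + j) l \<ge> 1\<close> for \<open>k + j \<ge> 2\<close>.\<close>

lemma charge_constant_bounds:
  assumes l: "l \<ge> 1 / 2" and k: "k \<ge> 1"
  shows "0 < charge_constant l k" "charge_constant l k \<le> (2 * pi) powi (1 - int k)"
proof -
  have gp: "Gamma (real i * l + 1) > 0" for i using l by (intro Gamma_real_pos add_nonneg_pos) auto
  have gp': "Gamma (l + 1) > 0" using l by (intro Gamma_real_pos) auto
  have pw: "(2 * pi) powi (1 - int k) > 0" by (intro zero_less_power_int) auto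
  show "0 < charge_constant l k"
    unfolding charge_constant_def
    by (intro mult_pos_pos divide_pos_pos prod_pos ballI zero_less_power gp gp' pw)
  have 1: "Gamma (l + 1) ^ i \<le> Gamma (real i * l + 1)" for i
  proof (induction i)
    case (Suc i)
    have "Gamma (l + 1) ^ Suc i \<le> Gamma (l + 1) * Gamma (real i * l + 1)"
      using Suc gp' by simp
    also have "\<dots> \<le> Gamma (l + real i * l + 1)" using l by (intro Gamma_mult_le) auto
    finally show ?case by (simp add: algebra_simps)
  qed simp
  have 2: "Gamma (real j * l + 1) / Gamma (real (k + j) * l + 1) \<le> 1" if j: "j \<in> {1..k - 1}" for j
  proof -
    have "real (k + j) \<ge> 2" using j k by auto
    then have "real (k + j) * l \<ge> 2 * (1 / 2)" using l by (intro mult_mono) auto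
    then have "Gamma (real j * l + 1) \<le> Gamma (real (k + j) * l + 1)"
      using l by (intro Gamma_le_Gamma) (auto intro!: mult_right_mono)
    then show ?thesis using gp[of "k + j"] by (simp add: divide_le_eq_1)
  qed
  have "charge_constant l k = (2 * pi) powi (1 - int k) * (Gamma (l + 1) ^ k / Gamma (real k * l + 1))
     * (\<Prod>j = 1..k - 1. Gamma (real j * l + 1) / Gamma (real (k + j) * l + 1))"
    by (simp add: charge_constant_def)
  also have "\<dots> \<le> (2 * pi) powi (1 - int k) * 1 * 1"
  proof (intro mult_mono prod_le_1 conjI 2)
    show "0 \<le> (\<Prod>j = 1..k - 1. Gamma (real j * l + 1) / Gamma (real (k + j) * l + 1))"
      by (intro prod_nonneg ballI divide_nonneg_nonneg less_imp_le gp)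
    show "0 \<le> Gamma (real j * l + 1) / Gamma (real (k + j) * l + 1)" for j
      by (intro divide_nonneg_nonneg less_imp_le gp)
    show "0 \<le> Gamma (l + 1) ^ k / Gamma (real k * l + 1)"
      using gp' by (intro divide_nonneg_nonneg less_imp_le[OF gp] zero_le_power) auto
    show "Gamma (l + 1) ^ k / Gamma (real k * l + 1) \<le> 1" using 1[of k] gp[of k] by (simp add: divide_le_eq_1)
  qed (use gp gp' pw in auto)
  finally show "charge_constant l k \<le> (2 * pi) powi (1 - int k)" by simp
qed

text \<open>Log-convexity gives the bound \<open>(x + s) powr s\<close> with \<open>x + s = l (n + i) + 1\<close>, which exceeds \<open>2 l n\<close> when \<open>l (n - i) < 1\<close>.
Since \<open>y \<le> exp (y - 1)\<close>, the excess costs a factor of at most \<open>exp 1\<close>, which one of the \<open>k - 1\<close> factors \<open>1 / (2 pi)\<close> absorbs.\<close>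

lemma Gamma_ratio_charge_bound:
  assumes l: "l \<ge> 1 / 2" and i: "i \<ge> 1" "i < n"
  shows "Gamma (l * (real n + real i) + 1) / Gamma (l * (real n - real i) + 1) \<le> 2 * pi * (2 * l * real n) powr (2 * real i * l)"
proof -
  define x where "x = l * (real n - real i) + 1"
  define s where "s = 2 * real i * l"
  define N where "N = 2 * l * real n"
  have ni: "real n - real i \<ge> 1" using i by linarith
  have x: "x > 0" unfolding x_def using l ni by (intro add_nonneg_pos) auto
  have s: "s \<ge> 0" using l by (simp add: s_def)
  have N: "N > 0" using l i by (simp add: N_def)
  have xs: "x + s = l * (real n + real i) + 1" by (simp add: x_def s_def algebra_simps)
  have "(x + s) / N \<le> exp ((x + s) / N - 1)"
    using exp_ge_add_one_self[of "(x + s) / N - 1"] by simp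
  then have "((x + s) / N) powr s \<le> exp ((x + s) / N - 1) powr s"
    using x s N by (intro powr_mono2) auto
  also have "\<dots> = exp (s * ((x + s) / N - 1))" by (simp add: powr_def)
  also have "\<dots> \<le> exp 1"
  proof -
    define c where "c = 1 - l * (real n - real i)"
    have "x + s = N + c" unfolding xs N_def c_def by (simp add: algebra_simps)
    then have "(x + s) / N - 1 = c / N" using N by (simp add: add_divide_distrib)
    then have "s * ((x + s) / N - 1) = real i * c / real n"
      using l i by (simp add: N_def s_def)
    then have "s * ((x + s) / N - 1) = real i * (1 - l * (real n - real i)) / real n"
      by (simp only: c_def)
    also have "\<dots> \<le> real i * 1 / real n"
      using l ni by (intro divide_right_mono mult_left_mono) auto
    also have "\<dots> \<le> 1" using i by simp
    finally show ?thesis by simp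
  qed
  also have "\<dots> \<le> 2 * pi" using exp_le pi_gt3 by linarith
  finally have "(x + s) powr s \<le> 2 * pi * N powr s"
    using x s N by (simp add: powr_divide divide_le_eq)
  moreover have "Gamma (x + s) / Gamma x \<le> (x + s) powr s" by (rule Gamma_ratio_upper[OF x s])
  ultimately have "Gamma (x + s) / Gamma x \<le> 2 * pi * N powr s" by linarith
  then show ?thesis unfolding xs unfolding x_def s_def N_def .
qed

lemma Gamma_ratio_charge_limit:
  assumes l: "l > 0"
  shows "(\<lambda>n. Gamma (l * (real n + real i) + 1) / Gamma (l * (real n - real i) + 1) / real n powr (2 * real i * l))
    \<longlonglongrightarrow> l powr (2 * real i * l)"
proof -
  define s where "s = 2 * real i * l"
  have s: "s \<ge> 0" using l by (simp add: s_def)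
  define x where "x n = l * (real n - real i) + 1" for n
  have xlim: "filterlim x at_top sequentially" unfolding x_def using l by real_asymp
  have "(\<lambda>n. x n / real n) \<longlonglongrightarrow> l" unfolding x_def using l by real_asymp
  then have "(\<lambda>n. (x n / real n) powr s) \<longlonglongrightarrow> l powr s"
    using l by (intro tendsto_powr tendsto_const) auto
  from tendsto_mult[OF filterlim_compose[OF Gamma_ratio_asymp[OF s] xlim] this]
  have "(\<lambda>n. Gamma (x n + s) / (Gamma (x n) * x n powr s) * (x n / real n) powr s) \<longlonglongrightarrow> l powr s"
    by simp
  moreover have "eventually (\<lambda>n. Gamma (x n + s) / (Gamma (x n) * x n powr s) * (x n / real n) powr s
     = Gamma (l * (real n + real i) + 1) / Gamma (l * (real n - real i) + 1) / real n powr s) sequentially"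
    using eventually_gt_at_top[of i]
  proof eventually_elim
    case (elim n)
    have "real n - real i \<ge> 0" using elim by simp
    then have "x n > 0" using l by (auto simp: x_def intro!: add_nonneg_pos)
    moreover have e: "l * (real n + real i) + 1 = x n + s" "l * (real n - real i) + 1 = x n"
      by (auto simp: x_def s_def algebra_simps)
    ultimately show ?case unfolding e by (simp add: powr_divide)
  qed
  ultimately show ?thesis unfolding s_def by (rule Lim_transform_eventually)
qed

lemma C_charge_le:
  assumes \<beta>: "\<beta> \<ge> 1" and k: "k \<ge> 1" and n: "n \<ge> k"
  shows "C_charge \<beta> (n - k) k \<le> C_one \<beta> n * (real n * \<beta>) powr (real k * (real k - 1) * \<beta> / 2)"
proof -
  define l where "l = \<beta> / 2"
  have l: "l \<ge> 1 / 2" using \<beta> by (simp add: l_def)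
  have N: "2 * l * real n > 0" using l k n by simp
  let ?R = "\<Prod>i = 1..k - 1. Gamma (l * (real n + real i) + 1) / Gamma (l * (real n - real i) + 1)"
  have pos: "0 \<le> Gamma (l * (real n + real i) + 1) / Gamma (l * (real n - real i) + 1)" if "i \<in> {1..k - 1}" for i
  proof -
    have "0 \<le> l * (real n + real i)" "0 \<le> l * (real n - real i)"
      using l n that by auto
    then show ?thesis by (intro divide_nonneg_nonneg less_imp_le Gamma_real_pos) auto
  qed
  then have Rn: "?R \<ge> 0" by (intro prod_nonneg) auto
  have "?R \<le> (\<Prod>i = 1..k - 1. 2 * pi * (2 * l * real n) powr (2 * real i * l))"
  proof (intro prod_mono conjI)
    fix i assume i: "i \<in> {1..k - 1}"
    then show "0 \<le> Gamma (l * (real n + real i) + 1) / Gamma (l * (real n - real i) + 1)"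
      by (rule pos)
    show "Gamma (l * (real n + real i) + 1) / Gamma (l * (real n - real i) + 1) \<le> 2 * pi * (2 * l * real n) powr (2 * real i * l)"
      using i n by (intro Gamma_ratio_charge_bound l) auto
  qed
  also have "\<dots> = (2 * pi) ^ (k - 1) * (2 * l * real n) powr (real k * (real k - 1) * l)"
    using prod_charge_powr[OF N, where k = k and l = l] by (simp add: prod.distrib)
  finally have R: "?R \<le> (2 * pi) ^ (k - 1) * (2 * l * real n) powr (real k * (real k - 1) * l)" .
  have "(2 * pi) powi (1 - int k + int (k - 1)) = (2 * pi) powi (1 - int k) * (2 * pi) powi int (k - 1)"
    by (rule power_int_add) auto
  moreover have "1 - int k + int (k - 1) = 0" using k by simp
  ultimately have c: "(2 * pi) powi (1 - int k) * (2 * pi) ^ (k - 1) = 1"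
    by (simp only: power_int_of_nat power_int_0_right)
  have "charge_constant l k * ?R \<le> (2 * pi) powi (1 - int k) * ((2 * pi) ^ (k - 1) * (2 * l * real n) powr (real k * (real k - 1) * l))"
    using charge_constant_bounds[OF l k] R Rn by (intro mult_mono) auto
  also have "\<dots> = (2 * l * real n) powr (real k * (real k - 1) * l)"
    unfolding mult.assoc[symmetric] c by simp
  finally show ?thesis
    unfolding C_charge_over_C_one(1)[OF \<beta> k n]
    using C_charge_over_C_one(2)[OF \<beta> k n] by (intro mult_left_mono) (auto simp: l_def mult_ac)
qed

lemma C_charge_limit:
  assumes \<beta>: "\<beta> \<ge> 1" and k: "k \<ge> 1"
  shows "(\<lambda>n. C_charge \<beta> (n - k) k / (C_one \<beta> n * real n powr (real k * (real k - 1) * \<beta> / 2))) \<longlonglongrightarrow> A_charge \<beta> k"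
proof -
  define l where "l = \<beta> / 2"
  have l: "l > 0" using \<beta> by (simp add: l_def)
  define R where "R n i = Gamma (l * (real n + real i) + 1) / Gamma (l * (real n - real i) + 1)" for n i :: nat
  have "(\<lambda>n. charge_constant l k * (\<Prod>i = 1..k - 1. R n i / real n powr (2 * real i * l)))
      \<longlonglongrightarrow> charge_constant l k * (\<Prod>i = 1..k - 1. l powr (2 * real i * l))"
    unfolding R_def by (intro tendsto_mult tendsto_const tendsto_prod Gamma_ratio_charge_limit l)
  also have "charge_constant l k * (\<Prod>i = 1..k - 1. l powr (2 * real i * l)) = A_charge \<beta> k"
    unfolding prod_charge_powr[OF l] A_charge_eq by (simp add: l_def)
  finally show ?thesis
  proof (rule Lim_transform_eventually)
    show "eventually (\<lambda>n. charge_constant l k * (\<Prod>i = 1..k - 1. R n i / real n powr (2 * real i * l))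
       = C_charge \<beta> (n - k) k / (C_one \<beta> n * real n powr (real k * (real k - 1) * \<beta> / 2))) sequentially"
      using eventually_ge_at_top[of k]
    proof eventually_elim
      case (elim n)
      have n: "real n > 0" using elim k by simp
      have "(\<Prod>i = 1..k - 1. R n i / real n powr (2 * real i * l)) = (\<Prod>i = 1..k - 1. R n i) / real n powr (real k * (real k - 1) * l)"
        unfolding prod_dividef prod_charge_powr[OF n] ..
      moreover have "C_charge \<beta> (n - k) k = C_one \<beta> n * (charge_constant l k * (\<Prod>i = 1..k - 1. R n i))"
        using C_charge_over_C_one(1)[OF \<beta> k elim] by (simp add: R_def l_def)
      ultimately show ?case
        using C_charge_over_C_one(2)[OF \<beta> k elim] by (simp add: l_def)
    qed
  qed
qed

lemma A_two_eq: "A_two \<beta> = A_charge \<beta> 2"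
proof -
  have p: "(\<Prod>j = 1..2 - 1. Gamma (real j * \<beta> / 2 + 1) / Gamma (real (2 + j) * \<beta> / 2 + 1))
      = Gamma (\<beta> / 2 + 1) / Gamma (3 * \<beta> / 2 + 1)" by simp
  have "A_charge \<beta> 2 = inverse (2 * pi) * Gamma (\<beta> / 2 + 1) ^ 2 / Gamma (\<beta> + 1)
      * (Gamma (\<beta> / 2 + 1) / Gamma (3 * \<beta> / 2 + 1)) * (\<beta> / 2) powr \<beta>"
    unfolding A_charge_def p by (simp add: power_int_minus)
  then show ?thesis
    by (simp only: A_two_def power3_eq_cube power2_eq_square divide_inverse inverse_mult_distrib mult_ac)
qed

theorem lemma1p1:
  fixes \<beta> :: real and k :: nat
  assumes "\<beta> \<ge> 1" and "k \<ge> 1"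
  shows "(\<forall>n\<ge>k. C_charge \<beta> (n - k) k
                  \<le> C_one \<beta> n * (real n * \<beta>) powr (real k * (real k - 1) * \<beta> / 2))
       \<and> (\<lambda>n. C_two \<beta> (n - 2) 1 / (C_one \<beta> n * real n powr \<beta>)) \<longlonglongrightarrow> A_two \<beta>
       \<and> (\<lambda>n. C_charge \<beta> (n - k) k
                / (C_one \<beta> n * real n powr (real k * (real k - 1) * \<beta> / 2))) \<longlonglongrightarrow> A_charge \<beta> k
       \<and> A_two \<beta> = A_charge \<beta> 2"
proof (intro conjI allI impI)
  show "C_charge \<beta> (n - k) k \<le> C_one \<beta> n * (real n * \<beta>) powr (real k * (real k - 1) * \<beta> / 2)" if "n \<ge> k" for n
    by (rule C_charge_le[OF assms that])
  show "(\<lambda>n. C_charge \<beta> (n - k) k / (C_one \<beta> n * real n powr (real k * (real k - 1) * \<beta> / 2))) \<longlonglongrightarrow> A_charge \<beta> k"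
    by (rule C_charge_limit[OF assms])
  show "(\<lambda>n. C_two \<beta> (n - 2) 1 / (C_one \<beta> n * real n powr \<beta>)) \<longlonglongrightarrow> A_two \<beta>"
    using C_charge_limit[OF assms(1), of 2] unfolding C_two_eq A_two_eq by simp
  show "A_two \<beta> = A_charge \<beta> 2" by (rule A_two_eq)
qed

end
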